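(* Let $X=\mathbb{R}\times G$, where $G$ is a finite Abelian group containing no elements of order $2$. Let $\alpha$ be a topological automorphism of $X$; it has the form $\alpha(t,g)=(at,\alpha_G g)$ for $t\in\mathbb{R}$, $g\in G$, where $a$ is a nonzero real number and $\alpha_G$ is an automorphism of $G$. Set $K=\mathrm{Ker}(I+\alpha_G)\subset G$. Let $\xi_1$ and $\xi_2$ be independent random variables with values in $X$ and distributions $\mu_1$ and $\mu_2$ whose characteristic functions do not vanish anywhere on the character group of $X$. Assume that the conditional distribution of the linear form $L_2=\xi_1+\alpha\xi_2$ given $L_1=\xi_1+\xi_2$ is symmetric. If $a\neq-1$, then $\mu_j=\gamma_j*\omega*E_{x_j}$, $j=1,2$, where $\gamma_j$ is a Gaussian distribution on $\mathbb{R}$ (regarded as the subgroup $\mathbb{R}\times\{0\}$ of $X$), $\omega$ is a distribution supported in $K$, and $x_j\in X$. If $a=-1$, then $\mu_j=\omega*E_{x_j}$, $j=1,2$, where $\omega$ is a distribution supported in $\mathbb{R}\times K$ and $x_j\in X$.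
   Context: For a locally compact Abelian group $X$ with character group $Y$, the characteristic function of a probability distribution $\mu$ on $X$ is $\hat\mu(y)=\int_X (x,y)\,d\mu(x)$, $y\in Y$, where $(x,y)$ is the value of the character $y$ at $x$. $E_x$ denotes the degenerate distribution at $x$, and $*$ denotes convolution. A Gaussian distribution on $\mathbb{R}$ is one with characteristic function $\exp\{-\sigma s^2+i\beta s\}$ with $\sigma\ge0$, $\beta\in\mathbb{R}$ (degenerate distributions included). "The conditional distribution of $L_2$ given $L_1$ is symmetric" means that the random vectors $(L_1,L_2)$ and $(L_1,-L_2)$ have the same distribution. *)

theory Defs
  imports "HOL-Probability.Probability"
begin

definition Xsp :: "(real \<times> 'g) measure" where
  "Xsp = (borel :: real measure) \<Otimes>\<^sub>M count_space (UNIV :: 'g set)"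

definition xadd :: "real \<times> 'g::ab_group_add \<Rightarrow> real \<times> 'g \<Rightarrow> real \<times> 'g" where
  "xadd x y = (fst x + fst y, snd x + snd y)"

definition xneg :: "real \<times> 'g::ab_group_add \<Rightarrow> real \<times> 'g" where
  "xneg x = (- fst x, - snd x)"

definition is_character :: "('g::ab_group_add \<Rightarrow> complex) \<Rightarrow> bool" where
  "is_character chi \<longleftrightarrow> (\<forall>x y. chi (x + y) = chi x * chi y) \<and> (\<forall>x. norm (chi x) = 1)"

text \<open>Characteristic function of a distribution on X at the character y = (s, chi) of X,
  i.e. (t,g) |-> exp(i s t) chi(g).\<close>
definition charfunX :: "(real \<times> 'g) measure \<Rightarrow> real \<Rightarrow> ('g \<Rightarrow> complex) \<Rightarrow> complex" where
  "charfunX \<mu> s chi = (CLINT x|\<mu>. iexp (s * fst x) * chi (snd x))"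

definition convX :: "(real \<times> 'g::ab_group_add) measure \<Rightarrow> (real \<times> 'g) measure \<Rightarrow> (real \<times> 'g) measure" where
  "convX \<mu> \<nu> = distr (\<mu> \<Otimes>\<^sub>M \<nu>) Xsp (\<lambda>(x, y). xadd x y)"

definition degX :: "real \<times> 'g \<Rightarrow> (real \<times> 'g) measure" where
  "degX x = return Xsp x"

definition distrX :: "(real \<times> 'g) measure \<Rightarrow> bool" where
  "distrX \<mu> \<longleftrightarrow> prob_space \<mu> \<and> sets \<mu> = sets Xsp"

text \<open>Gaussian distributions on R (degenerate ones included), via characteristic function.\<close>
definition gaussian_R :: "real measure \<Rightarrow> bool" where
  "gaussian_R \<gamma> \<longleftrightarrow> prob_space \<gamma> \<and> sets \<gamma> = sets borel \<and>
     (\<exists>\<sigma> \<beta>. \<sigma> \<ge> 0 \<and> (\<forall>s. char \<gamma> s = exp (complex_of_real (- \<sigma> * s\<^sup>2) + \<i> * complex_of_real (\<beta> * s))))"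

definition embR :: "real measure \<Rightarrow> (real \<times> 'g::zero) measure" where
  "embR \<gamma> = distr \<gamma> Xsp (\<lambda>t. (t, 0))"

end

theory Submission
  imports Defs "HOL-Library.Function_Algebras"
begin

text \<open>
  Write \<open>f\<^sub>j\<close> for the characteristic functions and \<open>\<epsilon>\<close> for the adjoint of \<open>\<alpha>\<close>. The symmetry hypothesis says
  \<open>f\<^sub>1(u + v) f\<^sub>2(u + \<epsilon>v) = f\<^sub>1(u - v) f\<^sub>2(u - \<epsilon>v)\<close>.
  On the characters of \<open>G\<close>, taking differences in \<open>ln |f\<^sub>j|\<close> eliminates one function and leaves a vanishing
  third difference; boundedness on a finite group then forces \<open>|f\<^sub>j| = 1\<close> on the multiples
  \<open>4 \<epsilon>(1 + \<epsilon>)\<chi>\<close>. Since there is no 2-torsion, the \<open>G\<close>-component of \<open>\<xi>\<^sub>j\<close> lies almost surely in one coset of \<open>K\<close>,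
  and a shift moves both components into \<open>K\<close>, where \<open>\<alpha>\<close> acts as \<open>-1\<close>. The equation becomes
  \<open>f\<^sub>1(s + t, x) f\<^sub>2(s + at, y) = f\<^sub>1(s - t, y) f\<^sub>2(s - at, x)\<close> for arbitrary characters \<open>x, y\<close>.
  If \<open>a = -1\<close>, setting \<open>y = 1\<close>, \<open>s = t\<close> gives \<open>f\<^sub>1 = f\<^sub>2\<close>. Otherwise it splits \<open>f\<^sub>j(s, x)\<close> into \<open>f\<^sub>j(s, 1) f\<^sub>1(0, x)\<close>,
  and on the real line the third differences of \<open>ln f\<^sub>j\<close> vanish, or (if \<open>a = 1\<close>) \<open>|f\<^sub>j| = 1\<close>, so
  \<open>f\<^sub>j(\<cdot>, 1)\<close> is Gaussian.
\<close>

section \<open>Characters of finite abelian groups\<close>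

definition nmul :: "nat \<Rightarrow> 'g::ab_group_add \<Rightarrow> 'g" where
  "nmul k x = ((+) x ^^ k) 0"

lemma nmul_0 [simp]: "nmul 0 x = 0"
  and nmul_Suc [simp]: "nmul (Suc k) x = x + nmul k x"
  by (simp_all add: nmul_def)

lemma nmul_add: "nmul (j + k) x = nmul j x + nmul k x"
  by (induction j) (simp_all add: add.assoc)

lemma nmul_distrib: "nmul n (x + y) = nmul n x + nmul n y"
  by (induction n) (simp_all add: algebra_simps)

lemma finite_order:
  fixes x :: "'g::{ab_group_add, finite}"
  shows "\<exists>k>0. nmul k x = 0"
proof -
  have "\<not> inj (\<lambda>k. nmul k x)"
    using finite_imageD[of "\<lambda>k. nmul k x" UNIV] by auto
  then obtain i j where ij: "nmul i x = nmul j x" "i < j"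
    unfolding inj_def by (metis nat_neq_iff)
  have "nmul (i + (j - i)) x = nmul i x + nmul (j - i) x"
    by (rule nmul_add)
  with ij have "nmul (j - i) x = 0" by simp
  with ij show ?thesis by (intro exI[of _ "j - i"]) auto
qed

section \<open>Extension of characters from subgroups\<close>

definition partial_char :: "'g::ab_group_add set \<Rightarrow> ('g \<Rightarrow> complex) \<Rightarrow> bool" where
  "partial_char H chi \<longleftrightarrow> 0 \<in> H \<and> (\<forall>x\<in>H. \<forall>y\<in>H. x + y \<in> H \<and> chi (x + y) = chi x * chi y)
     \<and> (\<forall>x\<in>H. norm (chi x) = 1)"

lemma partial_char_nmul: "partial_char H chi \<Longrightarrow> x \<in> H \<Longrightarrow> nmul k x \<in> H"
  by (induction k) (auto simp: partial_char_def)

text \<open>If \<open>k * y = 0\<close> with \<open>k > 0\<close>, then \<open>(k - 1) * y\<close>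
  is \<open>- y\<close>; closure under addition therefore gives closure under differences in a
  finite group.\<close>

lemma partial_char_diff:
  fixes x :: "'g::{ab_group_add, finite}"
  assumes "partial_char H chi" "x \<in> H" "y \<in> H"
  shows "x - y \<in> H"
proof -
  obtain k where k: "k > 0" "nmul k y = 0" using finite_order by blast
  then obtain j where j: "k = Suc j" using gr0_implies_Suc by blast
  have "nmul j y = - y" using k j by (simp add: add_eq_0_iff)
  then have "x - y = x + nmul j y" by simp
  moreover have "x + nmul j y \<in> H"
    using partial_char_nmul[OF assms(1,3), of j] assms by (auto simp: partial_char_def)
  ultimately show ?thesis by (simp only:)
qed

lemma partial_char_0:
  assumes "partial_char H chi" shows "chi 0 = 1"
proof -
  have "chi (0 + 0) = chi 0 * chi 0" "norm (chi 0) = 1"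
    using assms unfolding partial_char_def by blast+
  then show ?thesis by (metis add_0 mult_cancel_right1 norm_zero zero_neq_one)
qed

text \<open>Sending \<open>h + kx\<close> to \<open>chi h * z ^ k\<close> is well defined because \<open>nmul k x \<in> H\<close> only for multiples \<open>k\<close> of \<open>n\<close>.\<close>
lemma partial_char_extend:
  fixes x :: "'g::{ab_group_add, finite}"
  assumes H: "partial_char H chi" and n: "n > 0" "nmul n x \<in> H"
    and least: "\<And>k. 0 < k \<Longrightarrow> k < n \<Longrightarrow> nmul k x \<notin> H"
    and z: "z ^ n = chi (nmul n x)" "norm z = 1"
  shows "\<exists>H' chi'. partial_char H' chi' \<and> H \<subseteq> H' \<and> x \<in> H' \<and> (\<forall>h\<in>H. chi' h = chi h) \<and> chi' x = z"
proof -
  \<comment> \<open>Strong induction removes \<open>n\<close> at a time: \<open>least\<close>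
    excludes a remainder strictly between 0 and \<open>n\<close>, so the descent ends at 0.\<close>
  have pow: "chi (nmul k x) = z ^ k" if "nmul k x \<in> H" for k
    using that
  proof (induction k rule: less_induct)
    case (less k)
    consider "k = 0" | "0 < k" "k < n" | "k \<ge> n" by linarith
    then show ?case
    proof cases
      case 1
      then show ?thesis using partial_char_0[OF H] by simp
    next
      case 2
      then show ?thesis using least less.prems by blast
    next
      case 3
      have eq: "nmul k x = nmul (k - n) x + nmul n x"
        using nmul_add[of "k - n" n x] 3 by simp
      have mem: "nmul (k - n) x \<in> H"
        using partial_char_diff[OF H less.prems n(2)] eq by simp
      then have "chi (nmul (k - n) x) = z ^ (k - n)"
        using less.IH[of "k - n"] n 3 by simp
      then have "chi (nmul k x) = z ^ (k - n) * z ^ n"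
        using H mem n(2) z unfolding eq partial_char_def by simp
      then show ?thesis using 3 by (simp flip: power_add)
    qed
  qed
  define H' where "H' = {h + nmul k x | h k. h \<in> H}"
  \<comment> \<open>The choice is harmless on \<open>H'\<close>: \<open>ord\<close> shows that two
    representations of the same element give the same value, and \<open>val\<close> then evaluates
    it.\<close>
  define chi' where "chi' y = (SOME v. \<exists>h k. h \<in> H \<and> y = h + nmul k x \<and> v = chi h * z ^ k)" for y
  have ord: "chi h * z ^ k = chi h' * z ^ k'"
    if "h \<in> H" "h' \<in> H" "h + nmul k x = h' + nmul k' x" "k' \<le> k" for h h' k k'
  proof -
    have "nmul k x = nmul (k - k') x + nmul k' x" using nmul_add[of "k - k'" k' x] that by simp
    with that(3) have *: "h' = h + nmul (k - k') x" by (simp add: algebra_simps)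
    then have mem: "nmul (k - k') x \<in> H" using partial_char_diff[OF H that(2,1)] by simp
    have "chi h' = chi h * z ^ (k - k')"
      using H that(1) mem pow[OF mem] unfolding * partial_char_def by simp
    then show ?thesis using that(4) by (simp flip: power_add)
  qed
  have val: "chi' (h + nmul k x) = chi h * z ^ k" if "h \<in> H" for h k
  proof -
    have "\<exists>h' k'. h' \<in> H \<and> h + nmul k x = h' + nmul k' x \<and> chi' (h + nmul k x) = chi h' * z ^ k'"
      unfolding chi'_def by (rule someI[of _ "chi h * z ^ k"]) (use that in blast)
    then obtain h' k' where "h' \<in> H" "h + nmul k x = h' + nmul k' x"
      "chi' (h + nmul k x) = chi h' * z ^ k'" by blast
    then show ?thesis using ord[of h h' k k'] ord[of h' h k' k] that by (metis nat_le_linear)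
  qed
  have "0 \<in> H" using H by (simp add: partial_char_def)
  have mem: "h + nmul k x \<in> H'" if "h \<in> H" for h k using that by (auto simp: H'_def)
  have "partial_char H' chi'"
    unfolding partial_char_def
  proof (intro conjI ballI)
    show "0 \<in> H'" using mem[OF \<open>0 \<in> H\<close>, of 0] by simp
  next
    fix u v assume "u \<in> H'" "v \<in> H'"
    then obtain h k h' k' where uv: "u = h + nmul k x" "h \<in> H" "v = h' + nmul k' x" "h' \<in> H"
      by (auto simp: H'_def)
    have eq: "u + v = (h + h') + nmul (k + k') x" by (simp add: uv nmul_add algebra_simps)
    have hh: "h + h' \<in> H" "chi (h + h') = chi h * chi h'" using H uv by (auto simp: partial_char_def)
    show "u + v \<in> H'" unfolding eq by (rule mem[OF hh(1)])
    show "chi' (u + v) = chi' u * chi' v"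
      using val[OF hh(1), of "k + k'"] val[OF uv(2), of k] val[OF uv(4), of k']
      by (simp only: eq hh(2) power_add flip: uv(1,3)) (simp add: mult_ac)
  next
    fix u assume "u \<in> H'"
    then obtain h k where u: "u = h + nmul k x" "h \<in> H" by (auto simp: H'_def)
    then show "norm (chi' u) = 1"
      using H z by (simp add: val norm_mult norm_power partial_char_def)
  qed
  moreover have "H \<subseteq> H'" using mem[of _ 0] by auto
  moreover have "x \<in> H'" using mem[OF \<open>0 \<in> H\<close>, of 1] by simp
  moreover have "\<forall>h\<in>H. chi' h = chi h" using val[of _ 0] by auto
  moreover have "chi' x = z" using val[OF \<open>0 \<in> H\<close>, of 1] partial_char_0[OF H] by simp
  ultimately show ?thesis by blast
qed

lemma partial_char_first_multiple:
  fixes x :: "'g::{ab_group_add, finite}"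
  assumes "partial_char H chi"
  shows "\<exists>n>0. nmul n x \<in> H \<and> (\<forall>k. 0 < k \<longrightarrow> k < n \<longrightarrow> nmul k x \<notin> H)"
proof -
  have "\<exists>k. 0 < k \<and> nmul k x \<in> H"
    using finite_order[of x] assms unfolding partial_char_def by metis
  from exists_least_iff[THEN iffD1, OF this] show ?thesis by blast
qed

text \<open>A nontrivial value is prescribed at \<open>g\<close>, starting from the trivial
  subgroup. Among the partial characters keeping \<open>g\<close> nontrivial, one with a largest
  domain must be defined everywhere, since otherwise it could be extended by one more
  element.\<close>

lemma characters_separate:
  fixes g :: "'g::{ab_group_add, finite}"
  assumes "g \<noteq> 0"
  shows "\<exists>chi. is_character chi \<and> chi g \<noteq> 1"
proof -
  define good where "good H \<longleftrightarrow> (\<exists>chi. partial_char H chi \<and> g \<in> H \<and> chi g \<noteq> 1)" for H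
  have triv: "partial_char {0::'g} (\<lambda>_. 1)" by (simp add: partial_char_def)
  obtain n where n: "n > 0" "nmul n g \<in> {0}" "\<And>k. 0 < k \<Longrightarrow> k < n \<Longrightarrow> nmul k g \<notin> {0}"
    using partial_char_first_multiple[OF triv, of g] by blast
  have "n \<noteq> 1" using n(2) assms by auto
  with n(1) have n2: "n \<ge> 2" by simp
  \<comment> \<open>Here \<open>n\<close> is the order of \<open>g\<close>; it is at least 2, so
    this \<open>n\<close>-th root of unity differs from 1.\<close>
  define z where "z = cis (2 * pi / n)"
  have "z ^ n = 1" using n(1) by (simp add: z_def Complex.DeMoivre)
  have "z \<noteq> 1"
  proof
    assume "z = 1"
    then have "cos (2 * pi / n) = 1" by (simp add: z_def complex_eq_iff)
    then obtain m :: int where "2 * pi / n = m * 2 * pi" by (auto simp: cos_one_2pi_int)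
    then have "1 = real_of_int m * real n" using n(1) by (simp add: field_simps)
    then have "1 = m * int n" by (metis of_int_1 of_int_eq_iff of_int_mult of_int_of_nat_eq)
    then have "int n dvd 1" by (metis dvd_triv_right)
    then show False using n2 by simp
  qed
  have "norm z = 1" by (simp add: z_def)
  then obtain H0 chi0 where "partial_char H0 chi0" "g \<in> H0" "chi0 g = z"
    using partial_char_extend[OF triv n] \<open>z ^ n = 1\<close> by blast
  then have "good H0" using \<open>z \<noteq> 1\<close> unfolding good_def by blast
  then have "\<exists>H. good H \<and> (\<forall>H'. good H' \<longrightarrow> card H' \<le> card H)"
    by (intro ex_has_greatest_nat[where b = "Suc (card (UNIV :: 'g set))"])
       (auto simp: less_Suc_eq_le intro: card_mono)
  then obtain H where "good H" and maxi: "\<And>H'. good H' \<Longrightarrow> card H' \<le> card H" by blast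
  then obtain chi where H: "partial_char H chi" "g \<in> H" "chi g \<noteq> 1" unfolding good_def by blast
  have "H = UNIV"
  proof (rule ccontr)
    assume "H \<noteq> UNIV"
    then obtain x where x: "x \<notin> H" by blast
    obtain m where m: "m > 0" "nmul m x \<in> H" "\<And>k. 0 < k \<Longrightarrow> k < m \<Longrightarrow> nmul k x \<notin> H"
      using partial_char_first_multiple[OF H(1), of x] by blast
    have nrm: "norm (chi (nmul m x)) = 1" using H(1) m(2) by (simp add: partial_char_def)
    \<comment> \<open>An \<open>m\<close>-th root of the value already prescribed at
      \<open>nmul m x\<close>, as the extension to \<open>x\<close> requires.\<close>
    define w where "w = cis (Arg (chi (nmul m x)) / m)"
    have "w ^ m = cis (Arg (chi (nmul m x)))" using m(1) by (simp add: w_def Complex.DeMoivre)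
    also have "\<dots> = chi (nmul m x)"
      using nrm cis_Arg[of "chi (nmul m x)"] by (cases "chi (nmul m x) = 0") (simp_all add: sgn_eq)
    finally have "w ^ m = chi (nmul m x)" .
    moreover have "norm w = 1" by (simp add: w_def)
    ultimately obtain H' chi' where H': "partial_char H' chi'" "H \<subseteq> H'" "x \<in> H'"
        "\<forall>h\<in>H. chi' h = chi h"
      using partial_char_extend[OF H(1) m] by blast
    then have "good H'" using H unfolding good_def by (metis subsetD)
    moreover have "card H < card H'" using H' x by (intro psubset_card_mono) auto
    ultimately show False using maxi by fastforce
  qed
  with H show ?thesis by (auto simp: partial_char_def is_character_def)
qed

lemma is_character_partial_char: "is_character chi \<longleftrightarrow> partial_char UNIV chi"
  by (auto simp: is_character_def partial_char_def)

lemma is_character_0: "is_character chi \<Longrightarrow> chi 0 = 1"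
  by (simp add: is_character_partial_char partial_char_0)

lemma is_character_add: "is_character chi \<Longrightarrow> chi (x + y) = chi x * chi y"
  and is_character_norm: "is_character chi \<Longrightarrow> norm (chi x) = 1"
  by (simp_all add: is_character_def)

lemma is_character_cnj_mult: "is_character chi \<Longrightarrow> chi x * cnj (chi x) = 1"
  by (simp add: complex_norm_square[symmetric] is_character_norm)

lemma is_character_minus:
  assumes "is_character chi" shows "chi (- x) = cnj (chi x)"
proof -
  have "chi x * chi (- x) = chi x * cnj (chi x)"
    using is_character_add[OF assms, of x "- x"] is_character_0[OF assms] is_character_cnj_mult[OF assms]
    by simp
  moreover have "chi x \<noteq> 0" using is_character_norm[OF assms, of x] by auto
  ultimately show ?thesis by simp
qed

lemma is_character_diff: "is_character chi \<Longrightarrow> chi (x - y) = chi x * cnj (chi y)"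
  using is_character_add[of chi x "- y"] is_character_minus[of chi y] by simp

lemma is_character_trivial: "is_character (\<lambda>_. 1)"
  by (simp add: is_character_def)

lemma is_character_mult:
  "is_character chi \<Longrightarrow> is_character psi \<Longrightarrow> is_character (\<lambda>x. chi x * psi x)"
  by (simp add: is_character_def norm_mult)

lemma is_character_cnj: "is_character chi \<Longrightarrow> is_character (\<lambda>x. cnj (chi x))"
  by (simp add: is_character_def)

lemma is_character_compose:
  "is_character chi \<Longrightarrow> (\<And>x y. \<phi> (x + y) = \<phi> x + \<phi> y) \<Longrightarrow> is_character (\<lambda>x. chi (\<phi> x))"
  by (simp add: is_character_def)

lemma is_character_nmul: "is_character chi \<Longrightarrow> chi (nmul k x) = chi x ^ k"
  by (induction k) (simp_all add: is_character_0 is_character_add)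

section \<open>Finiteness and orthogonality of the characters\<close>

lemma finite_characters: "finite {chi :: 'g::{ab_group_add, finite} \<Rightarrow> complex. is_character chi}"
proof -
  obtain k where k: "\<And>x::'g. k x > 0 \<and> nmul (k x) x = 0" using finite_order by metis
  have "chi x ^ k x = 1" if "is_character chi" for chi :: "'g \<Rightarrow> complex" and x
    using is_character_nmul[OF that, of "k x" x] k[of x] is_character_0[OF that] by simp
  \<comment> \<open>Each value is a root of unity whose order depends only on the argument, so the
    characters lie in a finite product of finite sets.\<close>
  then have "{chi :: 'g \<Rightarrow> complex. is_character chi} \<subseteq> PiE UNIV (\<lambda>x. {z. z ^ k x = 1})"
    by (auto simp: PiE_def)
  moreover have "finite (PiE UNIV (\<lambda>x::'g. {z::complex. z ^ k x = 1}))"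
    using k by (intro finite_PiE finite_roots_unity) (auto simp: Suc_le_eq)
  ultimately show ?thesis by (rule finite_subset)
qed

text \<open>Multiplication by a character \<open>chi0\<close> with \<open>chi0 g \<noteq> 1\<close>
  permutes the characters, so the sum equals \<open>chi0 g\<close> times itself. The number of
  characters stays unevaluated; later it only has to be nonzero.\<close>

lemma sum_characters:
  fixes g :: "'g::{ab_group_add, finite}"
  shows "(\<Sum>chi | is_character chi. chi g)
    = (if g = 0 then of_nat (card {chi :: 'g \<Rightarrow> complex. is_character chi}) else 0)"
proof (cases "g = 0")
  case True
  then show ?thesis by (simp add: is_character_0)
next
  case False
  then obtain chi0 where chi0: "is_character chi0" "chi0 g \<noteq> 1" using characters_separate by blast
  note inv = is_character_cnj_mult[OF chi0(1)]
  have "(\<Sum>chi | is_character chi. chi g) = (\<Sum>chi | is_character chi. chi0 g * chi g)"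
    by (rule sum.reindex_bij_witness[where i = "\<lambda>chi x. chi0 x * chi x"
          and j = "\<lambda>chi x. cnj (chi0 x) * chi x"])
       (use chi0 inv in \<open>auto simp: is_character_mult is_character_cnj fun_eq_iff mult.assoc[symmetric] mult.commute[of "cnj _"]\<close>)
  then have "(\<Sum>chi | is_character chi. chi g) = 0 \<or> chi0 g = 1"
    by (simp only: mult_cancel_right1 flip: sum_distrib_left)
  with chi0 False show ?thesis by simp
qed

section \<open>Finite differences and the functional equation on the real line\<close>

text \<open>The mixed third difference of \<open>P\<close> at 0 with steps \<open>x\<close>,
  \<open>y\<close>, \<open>z\<close>; it vanishes on quadratic polynomials.\<close>

definition third_diff :: "('h::ab_group_add \<Rightarrow> 'c::ab_group_add) \<Rightarrow> 'h \<Rightarrow> 'h \<Rightarrow> 'h \<Rightarrow> 'c" where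
  "third_diff P x y z =
     P (x + y + z) - P (x + y) - P (x + z) - P (y + z) + P x + P y + P z - P 0"

text \<open>The shifts \<open>(Ek, -k)\<close>, \<open>(El, l)\<close>, \<open>(m, m)\<close> of \<open>(u, v)\<close> leave \<open>u + Ev\<close>, \<open>u - Ev\<close>, \<open>u - v\<close> fixed respectively,
  so the alternating sum of the equation over the eight shifted points only retains \<open>P (u + v)\<close>.\<close>
lemma third_diff_eq_0:
  fixes P Q :: "'h::ab_group_add \<Rightarrow> 'c::ab_group_add"
  assumes E_add: "\<And>x y. E (x + y) = E x + E y"
    and S: "0 \<in> S" "\<And>x y. x \<in> S \<Longrightarrow> y \<in> S \<Longrightarrow> x - y \<in> S" "\<And>x. x \<in> S \<Longrightarrow> E x \<in> S"
    and eq: "\<And>u v. u \<in> S \<Longrightarrow> v \<in> S \<Longrightarrow> P (u + v) + Q (u + E v) = P (u - v) + Q (u - E v)"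
    and klm: "k \<in> S" "l \<in> S" "m \<in> S"
  shows "third_diff P (m + m) (E l + l) (E k - k) = 0"
proof -
  have E0: "E 0 = 0" using E_add[of 0 0] by simp
  have E_minus: "E (- x) = - E x" for x
    using E_add[of x "- x"] E0 by (simp add: add_eq_0_iff)
  have E_diff: "E (x - y) = E x - E y" for x y
    using E_add[of x "- y"] E_minus[of y] by simp
  have minus: "- x \<in> S" if "x \<in> S" for x using S(2)[OF S(1) that] by simp
  have plus: "x + y \<in> S" if "x \<in> S" "y \<in> S" for x y
    using S(2)[OF that(1) minus[OF that(2)]] by simp
  define d where "d u v = P (u + v) + Q (u + E v) - P (u - v) - Q (u - E v)" for u v
  have d0: "d u v = 0" if "u \<in> S" "v \<in> S" for u v
    using eq[OF that] by (simp add: d_def algebra_simps)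
  note mem = plus minus S klm
  have "0 = d (E k + E l + m) (l + m - k) - d (E l + m) (l + m) - d (E k + m) (m - k)
          - d (E k + E l) (l - k) + d (E k) (- k) + d (E l) l + d m m - d 0 0"
    by (simp add: d0 mem)
  also have "\<dots> = third_diff P (m + m) (E l + l) (E k - k)"
    by (simp add: d_def third_diff_def E_add E_diff E_minus E0 algebra_simps)
  finally show ?thesis by simp
qed

lemma bounded_affine_slope_0:
  fixes x c :: real
  assumes "\<And>n::nat. \<bar>x + real n * c\<bar> \<le> M"
  shows "c = 0"
proof (rule ccontr)
  assume "c \<noteq> 0"
  then obtain n :: nat where n: "(M + \<bar>x\<bar>) / \<bar>c\<bar> < real n" using reals_Archimedean2 by blast
  then have "M + \<bar>x\<bar> < real n * \<bar>c\<bar>" using \<open>c \<noteq> 0\<close> by (simp add: field_simps)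
  then have "M < \<bar>x + real n * c\<bar>" using abs_mult[of "real n" c] by simp
  then show False using assms[of n] by simp
qed

text \<open>Boundedness is used twice: the first differences are affine in \<open>n\<close> with
  slope \<open>c\<close>, so \<open>c = 0\<close>; then \<open>b\<close> itself is affine and
  bounded, hence constant.\<close>

lemma bounded_second_difference_const:
  fixes b :: "nat \<Rightarrow> real"
  assumes "\<And>n. \<bar>b n\<bar> \<le> M" "\<And>n. b (Suc (Suc n)) - 2 * b (Suc n) + b n = c"
  shows "b n = b 0"
proof -
  have *: "b (Suc n) - b n = (b 1 - b 0) + n * c" for n :: nat
  proof (induction n)
    case (Suc n)
    then show ?case using assms(2)[of n] by (simp add: algebra_simps)
  qed simp
  have "\<bar>(b 1 - b 0) + n * c\<bar> \<le> 2 * M" for n :: nat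
    using *[of n] assms(1)[of n] assms(1)[of "Suc n"] by linarith
  then have "c = 0" by (rule bounded_affine_slope_0)
  have **: "b n = b 0 + n * (b 1 - b 0)" for n :: nat
  proof (induction n)
    case (Suc n)
    then show ?case using *[of n] \<open>c = 0\<close> by (simp add: algebra_simps)
  qed simp
  then have "\<bar>b 0 + n * (b 1 - b 0)\<bar> \<le> M" for n :: nat
    by (subst **[symmetric]) (rule assms(1))
  then have "b 1 - b 0 = 0" by (rule bounded_affine_slope_0)
  with **[of n] show ?thesis by (simp only: mult_zero_right add_0_right)
qed

section \<open>Continuous solutions of additive equations on the line\<close>

lemma continuous_additive_real:
  fixes f :: "real \<Rightarrow> 'a::real_normed_vector"
  assumes cont: "continuous_on UNIV f" and add: "\<And>x y. f (x + y) = f x + f y"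
  shows "f x = x *\<^sub>R f 1"
proof -
  have f0: "f 0 = 0" using add[of 0 0] by simp
  have f_minus: "f (- x) = - f x" for x using add[of x "- x"] f0 by (simp add: add_eq_0_iff)
  have f_nat: "f (real n * x) = real n *\<^sub>R f x" for n x
    by (induction n) (simp_all add: f0 add distrib_right scaleR_add_left)
  have f_int: "f (of_int i * x) = of_int i *\<^sub>R f x" for i x
    by (cases i rule: int_cases2) (simp_all add: f_nat f_minus)
  have f_rat: "f q = q *\<^sub>R f 1" if "q \<in> \<rat>" for q
  proof -
    from that obtain i n where q: "q = of_int i / of_int n" "n > 0" by (auto elim: Rats_cases')
    have "of_int n *\<^sub>R f q = of_int i *\<^sub>R f 1"
      using f_int[of n q] f_int[of i 1] q by simp
    then have "inverse (of_int n) *\<^sub>R (of_int n *\<^sub>R f q) = inverse (of_int n) *\<^sub>R (of_int i *\<^sub>R f 1)"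
      by (simp only:)
    moreover have "inverse (of_int n) * of_int n = (1::real)" "inverse (of_int n) * of_int i = q"
      using q by (auto simp: field_simps)
    ultimately show ?thesis by (simp only: scaleR_scaleR scaleR_one)
  qed
  \<comment> \<open>Linearity passes from the rationals to their closure. Vector values are allowed
    because the later applications are to complex functions.\<close>
  have "closed {x. f x = x *\<^sub>R f 1}"
    using cont by (intro closed_Collect_eq continuous_intros)
  then have "closure \<rat> \<subseteq> {x. f x = x *\<^sub>R f 1}"
    using f_rat by (intro closure_minimal) blast+
  then show ?thesis unfolding Rats_closure_real by blast
qed

text \<open>The second difference \<open>B\<close> is symmetric, additive and continuous in each
  argument, so it is \<open>h * k\<close> times \<open>B 1 1\<close>. Subtracting the quadratic with
  this second difference leaves a continuous additive function.\<close>

lemma third_diff_0_quadratic: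
  fixes f :: "real \<Rightarrow> complex"
  assumes cont: "continuous_on UNIV f" and f0: "f 0 = 0"
    and diff: "\<And>x y z. third_diff f x y z = 0"
  shows "\<exists>c d. \<forall>x. f x = c * (of_real x)\<^sup>2 + d * of_real x"
proof -
  define B where "B h k = f (h + k) - f h - f k" for h k
  have contB: "continuous_on UNIV (\<lambda>h. B h k)" for k
    unfolding B_def by (intro continuous_intros continuous_on_compose2[OF cont]) auto
  have addB: "B (h + l) k = B h k + B l k" for h l k
    using diff[of h l k] f0 by (simp add: B_def third_diff_def algebra_simps)
  have symB: "B h k = B k h" for h k by (simp add: B_def algebra_simps)
  have B1: "B h k = h *\<^sub>R B 1 k" for h k by (rule continuous_additive_real[OF contB addB])
  then have B2: "B h k = (h * k) *\<^sub>R B 1 1" for h k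
    by (metis mult.commute scaleR_scaleR symB)
  define g where "g x = f x - (x\<^sup>2 / 2) *\<^sub>R B 1 1" for x
  have "g (x + y) = g x + g y" for x y
  proof -
    have "f (x + y) = f x + f y + (x * y) *\<^sub>R B 1 1" using B2[of x y] by (simp add: B_def algebra_simps)
    moreover have "(x + y)\<^sup>2 / 2 = x\<^sup>2 / 2 + y\<^sup>2 / 2 + x * y" by (simp add: power2_eq_square field_simps)
    ultimately show ?thesis by (simp only: g_def scaleR_add_left) (simp add: algebra_simps)
  qed
  moreover have "continuous_on UNIV g"
    unfolding g_def by (intro continuous_intros cont) auto
  ultimately have "g x = x *\<^sub>R g 1" for x by (intro continuous_additive_real)
  then have "f x = (B 1 1 / 2) * (of_real x)\<^sup>2 + g 1 * of_real x" for x
    by (metis (no_types, lifting) g_def diff_add_cancel add.commute scaleR_conv_of_real mult.commute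
        of_real_divide of_real_power of_real_numeral times_divide_eq_left times_divide_eq_right)
  then show ?thesis by blast
qed

text \<open>The values lie in the integer multiples of \<open>2 * pi * \<i>\<close>, so distinct
  ones are at least \<open>2 * pi\<close> apart and a continuous function on the line cannot jump.
  This turns multiplicative identities into identities between logarithms.\<close>

lemma exp_eq_1_continuous_imp_0:
  fixes h :: "real \<Rightarrow> complex"
  assumes cont: "continuous_on UNIV h" and "\<And>x. exp (h x) = 1" "h 0 = 0"
  shows "h x = 0"
proof -
  have "h constant_on UNIV"
  proof (rule continuous_discrete_range_constant[OF _ cont])
    fix x :: real
    have "2 * pi \<le> norm (h y - h x)" if "h y \<noteq> h x" for y
    proof -
      have "exp (h y - h x) = 1" using assms(2) by (simp add: exp_diff)
      then obtain n :: int where n: "Re (h y - h x) = 0" "Im (h y - h x) = of_int (2 * n) * pi"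
        unfolding exp_eq_1 by blast
      then have "n \<noteq> 0" using that by (auto simp: complex_eq_iff)
      then have "1 \<le> \<bar>real_of_int n\<bar>" by linarith
      then have "2 * pi \<le> \<bar>of_int (2 * n) * pi\<bar>" by (simp add: abs_mult)
      also have "\<dots> \<le> norm (h y - h x)" using abs_Im_le_cmod[of "h y - h x"] n by simp
      finally show ?thesis .
    qed
    then show "\<exists>e>0. \<forall>y. y \<in> UNIV \<and> h y \<noteq> h x \<longrightarrow> e \<le> norm (h y - h x)"
      by (intro exI[of _ "2 * pi"]) auto
  qed auto
  with assms(3) show ?thesis by (metis constant_on_def UNIV_I)
qed

lemma continuous_log_real:
  fixes f :: "real \<Rightarrow> complex"
  assumes "continuous_on UNIV f" "\<And>x. f x \<noteq> 0" "f 0 = 1"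
  shows "\<exists>g. continuous_on UNIV g \<and> g 0 = 0 \<and> (\<forall>x. f x = exp (g x))"
proof -
  obtain g where g: "continuous_on UNIV g" "\<And>x. f x = exp (g x)"
    using continuous_logarithm_on_contractible[of UNIV f] assms by auto
  have "exp (g 0) = 1" using g(2)[of 0] assms(3) by simp
  with g show ?thesis
    by (intro exI[of _ "\<lambda>x. g x - g 0"]) (auto simp: exp_diff intro!: continuous_intros)
qed

section \<open>Gaussian characteristic functions and the equation on the line\<close>

definition gauss_cf :: "(real \<Rightarrow> complex) \<Rightarrow> bool" where
  "gauss_cf f \<longleftrightarrow> (\<exists>\<sigma> \<beta>. \<sigma> \<ge> 0 \<and>
     (\<forall>s. f s = exp (complex_of_real (- \<sigma> * s\<^sup>2) + \<i> * complex_of_real (\<beta> * s))))"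

text \<open>Equal moduli at 1 and -1 force \<open>Re d = 0\<close>, and the bound at 1 then gives
  \<open>Re c \<le> 0\<close>. Hermitian symmetry leaves \<open>exp ((c - cnj c) * s^2) = 1\<close>
  for all \<open>s\<close>, so \<open>c\<close> is real.\<close>

lemma gauss_cf_exp_quadratic:
  assumes f: "\<And>s::real. f s = exp (c * (of_real s)\<^sup>2 + d * of_real s)"
    and herm: "\<And>s. f (- s) = cnj (f s)" and le: "\<And>s. norm (f s) \<le> 1"
  shows "gauss_cf f"
proof -
  have norm_f: "norm (f s) = exp (Re c * s\<^sup>2 + Re d * s)" for s
    unfolding f norm_exp_eq_Re by (simp flip: of_real_power)
  have "norm (f (- 1)) = norm (f 1)" by (simp add: herm)
  then have Red: "Re d = 0" by (simp add: norm_f)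
  have Rec: "Re c \<le> 0" using le[of 1] Red by (simp add: norm_f)
  have cnjd: "cnj d = - d" using Red by (simp add: complex_eq_iff)
  have "(c - cnj c) * (of_real 1)\<^sup>2 = 0"
  proof (rule exp_eq_1_continuous_imp_0[where h = "\<lambda>s. (c - cnj c) * (of_real s)\<^sup>2"])
    fix s :: real
    have "exp (c * (of_real s)\<^sup>2 - d * of_real s) = exp (cnj c * (of_real s)\<^sup>2 - d * of_real s)"
      using herm[of s] by (simp add: f exp_cnj cnjd)
    then have "exp ((c * (of_real s)\<^sup>2 - d * of_real s) - (cnj c * (of_real s)\<^sup>2 - d * of_real s)) = 1"
      by (simp add: exp_diff)
    then show "exp ((c - cnj c) * (of_real s)\<^sup>2) = 1" by (simp add: algebra_simps)
  qed (auto intro!: continuous_intros)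
  then have "c = cnj c" by simp
  then have c: "c = of_real (Re c)" by (simp add: complex_eq_iff)
  have d: "d = \<i> * of_real (Im d)" using Red by (simp add: complex_eq_iff)
  have "f s = exp (complex_of_real (- (- Re c) * s\<^sup>2) + \<i> * complex_of_real (Im d * s))" for s
    unfolding f by (subst c, subst d) (simp add: mult.assoc)
  then show ?thesis unfolding gauss_cf_def using Rec
    by (intro exI[of _ "- Re c"] exI[of _ "Im d"]) auto
qed

text \<open>The logarithms satisfy the additive equation, so \<open>third_diff_eq_0\<close> applies
  with multiplication by \<open>b\<close> as \<open>E\<close>. Its steps \<open>2 * m\<close>,
  \<open>(b + 1) * l\<close> and \<open>(b - 1) * k\<close> reach all real numbers because
  \<open>b\<close> is neither 1 nor -1.\<close>

lemma heyde_real_one: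
  fixes f1 f2 :: "real \<Rightarrow> complex"
  assumes cont: "continuous_on UNIV f1" "continuous_on UNIV f2"
    and nz: "\<And>s. f1 s \<noteq> 0" "\<And>s. f2 s \<noteq> 0"
    and one: "f1 0 = 1" "f2 0 = 1"
    and eq: "\<And>s t. f1 (s + t) * f2 (s + b * t) = f1 (s - t) * f2 (s - b * t)"
    and b: "b \<noteq> 1" "b \<noteq> -1"
  shows "\<exists>c d. \<forall>x. f1 x = exp (c * (of_real x)\<^sup>2 + d * of_real x)"
proof -
  obtain P1 where P1: "continuous_on UNIV P1" "P1 0 = 0" "\<And>x. f1 x = exp (P1 x)"
    using continuous_log_real[OF cont(1) nz(1) one(1)] by blast
  obtain Q1 where Q1: "continuous_on UNIV Q1" "Q1 0 = 0" "\<And>x. f2 x = exp (Q1 x)"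
    using continuous_log_real[OF cont(2) nz(2) one(2)] by blast
  have log_eq: "P1 (s + t) + Q1 (s + b * t) = P1 (s - t) + Q1 (s - b * t)" for s t
  proof -
    \<comment> \<open>The logarithms agree at once only modulo \<open>2 * pi * \<i>\<close>. Scaling
      both arguments by \<open>r\<close> joins the point to the origin, where the discrepancy is
      0.\<close>
    define h where "h r = P1 (r * (s + t)) + Q1 (r * (s + b * t)) - P1 (r * (s - t)) - Q1 (r * (s - b * t))" for r
    have "h 1 = 0"
    proof (rule exp_eq_1_continuous_imp_0)
      show "continuous_on UNIV h" unfolding h_def
        by (intro continuous_intros continuous_on_compose2[OF P1(1)] continuous_on_compose2[OF Q1(1)]) auto
      show "h 0 = 0" by (simp add: h_def P1 Q1)
      fix r
      have "exp (h r) = f1 (r * s + r * t) * f2 (r * s + b * (r * t))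
          / (f1 (r * s - r * t) * f2 (r * s - b * (r * t)))"
        by (simp add: h_def exp_diff exp_add P1 Q1 algebra_simps)
      also have "\<dots> = 1" unfolding eq using nz by simp
      finally show "exp (h r) = 1" .
    qed
    then show ?thesis by (simp add: h_def algebra_simps)
  qed
  have "third_diff P1 x y z = 0" for x y z
  proof -
    have "third_diff P1 (x / 2 + x / 2) (b * (y / (b + 1)) + y / (b + 1)) (b * (z / (b - 1)) - z / (b - 1)) = 0"
      by (rule third_diff_eq_0[where E = "\<lambda>x. b * x" and S = UNIV and P = P1 and Q = Q1])
         (auto simp: log_eq distrib_left)
    moreover have "b * (y / (b + 1)) + y / (b + 1) = y"
    proof -
      have "b + 1 \<noteq> 0" using b(2) by linarith
      moreover have "b * (y / (b + 1)) + y / (b + 1) = (b + 1) * (y / (b + 1))" by (simp only: distrib_right mult_1)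
      ultimately show ?thesis by simp
    qed
    moreover have "b * (z / (b - 1)) - z / (b - 1) = z"
    proof -
      have "b * (z / (b - 1)) - z / (b - 1) = (b - 1) * (z / (b - 1))" by (simp only: left_diff_distrib mult_1)
      then show ?thesis using b(1) by simp
    qed
    ultimately show ?thesis by simp
  qed
  then obtain c d where "\<And>x. P1 x = c * (of_real x)\<^sup>2 + d * of_real x"
    using third_diff_0_quadratic[OF P1(1,2)] by blast
  then have "\<forall>x. f1 x = exp (c * (of_real x)\<^sup>2 + d * of_real x)" by (simp add: P1(3))
  then show ?thesis by blast
qed

text \<open>Replacing \<open>t\<close> by \<open>t / a\<close> exchanges \<open>f1\<close> and
  \<open>f2\<close> and replaces \<open>a\<close> by its inverse, which again is neither 1 nor -1;
  so \<open>heyde_real_one\<close> covers both functions.\<close>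

lemma heyde_real:
  fixes f1 f2 :: "real \<Rightarrow> complex"
  assumes cont: "continuous_on UNIV f1" "continuous_on UNIV f2"
    and nz: "\<And>s. f1 s \<noteq> 0" "\<And>s. f2 s \<noteq> 0"
    and one: "f1 0 = 1" "f2 0 = 1"
    and herm: "\<And>s. f1 (- s) = cnj (f1 s)" "\<And>s. f2 (- s) = cnj (f2 s)"
    and le: "\<And>s. norm (f1 s) \<le> 1" "\<And>s. norm (f2 s) \<le> 1"
    and eq: "\<And>s t. f1 (s + t) * f2 (s + a * t) = f1 (s - t) * f2 (s - a * t)"
    and a: "a \<noteq> 0" "a \<noteq> 1" "a \<noteq> -1"
  shows "gauss_cf f1 \<and> gauss_cf f2"
proof
  obtain c d where "\<And>x. f1 x = exp (c * (of_real x)\<^sup>2 + d * of_real x)"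
    using heyde_real_one[OF cont nz one eq a(2,3)] by blast
  then show "gauss_cf f1" using herm(1) le(1) by (rule gauss_cf_exp_quadratic)
next
  have eq': "f2 (s + t) * f1 (s + inverse a * t) = f2 (s - t) * f1 (s - inverse a * t)" for s t
  proof -
    have "a * (inverse a * t) = t" using a(1) by simp
    then show ?thesis using eq[of s "inverse a * t"] by (simp only: mult.commute)
  qed
  have inv: "inverse a \<noteq> 1" "inverse a \<noteq> -1"
    using a by (metis inverse_1 inverse_inverse_eq, metis inverse_1 inverse_inverse_eq inverse_minus_eq)
  obtain c d where "\<And>x. f2 x = exp (c * (of_real x)\<^sup>2 + d * of_real x)"
    using heyde_real_one[OF cont(2,1) nz(2,1) one(2,1) eq' inv] by blast
  then show "gauss_cf f2" using herm(2) le(2) by (rule gauss_cf_exp_quadratic)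
qed

text \<open>The continuous logarithm is additive, hence linear, so the quadratic coefficient is 0.
  This is the degenerate Gaussian that arises for \<open>a = 1\<close>.\<close>

lemma gauss_cf_multiplicative:
  fixes f :: "real \<Rightarrow> complex"
  assumes cont: "continuous_on UNIV f" and mult: "\<And>s t. f (s + t) = f s * f t"
    and norm: "\<And>s. norm (f s) = 1" and herm: "\<And>s. f (- s) = cnj (f s)"
  shows "gauss_cf f"
proof -
  have nz: "f s \<noteq> 0" for s using norm[of s] by auto
  have one: "f 0 = 1" using mult[of 0 0] nz[of 0] by simp
  obtain g where g: "continuous_on UNIV g" "g 0 = 0" "\<And>x. f x = exp (g x)"
    using continuous_log_real[OF cont nz one] by blast
  have "g (s + t) = g s + g t" for s t
  proof -
    have "g (1 * s + 1 * t) - g (1 * s) - g (1 * t) = 0"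
    proof (rule exp_eq_1_continuous_imp_0[where h = "\<lambda>r. g (r * s + r * t) - g (r * s) - g (r * t)"])
      fix r
      show "exp (g (r * s + r * t) - g (r * s) - g (r * t)) = 1"
        using mult[of "r * s" "r * t"] nz by (simp add: exp_diff flip: g(3))
    qed (auto simp: g(2) intro!: continuous_intros continuous_on_compose2[OF g(1)])
    then show ?thesis by (simp add: algebra_simps)
  qed
  then have "g x = x *\<^sub>R g 1" for x by (intro continuous_additive_real g)
  then have "f s = exp (0 * (of_real s)\<^sup>2 + g 1 * of_real s)" for s
    by (metis g(3) scaleR_conv_of_real mult.commute mult_zero_left add_0)
  then show ?thesis using herm by (rule gauss_cf_exp_quadratic) (simp add: norm)
qed

text \<open>With \<open>z = E v - v\<close>, the bounded sequence \<open>P (nmul n z)\<close> has constant second differences, so \<open>P z = 0\<close>.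
  The equation at \<open>(E v, v)\<close> then makes a sum of two nonpositive terms vanish.\<close>
lemma heyde_bounded_vanishing:
  fixes P Q :: "'h::ab_group_add \<Rightarrow> real"
  assumes E_add: "\<And>x y. E (x + y) = E x + E y"
    and S: "0 \<in> S" "\<And>x y. x \<in> S \<Longrightarrow> y \<in> S \<Longrightarrow> x - y \<in> S" "\<And>x. x \<in> S \<Longrightarrow> E x \<in> S"
    and eq: "\<And>u v. u \<in> S \<Longrightarrow> v \<in> S \<Longrightarrow> P (u + v) + Q (u + E v) = P (u - v) + Q (u - E v)"
    and zero: "P 0 = 0" "Q 0 = 0"
    and nonpos: "\<And>x. x \<in> S \<Longrightarrow> P x \<le> 0" "\<And>x. x \<in> S \<Longrightarrow> Q x \<le> 0"
    and bdd: "\<And>x. x \<in> S \<Longrightarrow> M \<le> P x"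
    and x: "x \<in> S" and v: "v = x + E x + (x + E x)"
  shows "Q (E v + E v) = 0"
proof -
  have minus: "- x \<in> S" if "x \<in> S" for x using S(2)[OF S(1) that] by simp
  have plus: "x + y \<in> S" if "x \<in> S" "y \<in> S" for x y
    using S(2)[OF that(1) minus[OF that(2)]] by simp
  have E_minus: "E (- x) = - E x" for x
    using E_add[of x "- x"] E_add[of 0 0] by (simp add: add_eq_0_iff)
  have E_diff: "E (x - y) = E x - E y" for x y
    using E_add[of x "- y"] E_minus[of y] by simp
  have nmul_S: "nmul n y \<in> S" if "y \<in> S" for n y
    by (induction n) (simp_all add: S plus that)
  note mem = S(1,3) plus S(2) x nmul_S
  \<comment> \<open>Since \<open>v\<close> is twice \<open>(1 + E) x\<close>, the element
    \<open>z\<close> is at once \<open>E v - v\<close>, \<open>w + w\<close> and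
    \<open>E l + l\<close>. The three steps in \<open>third_diff_eq_0\<close> thus become
    \<open>nmul n z\<close>, \<open>z\<close> and \<open>z\<close>.\<close>
  define z where "z = E v - v"
  define w where "w = E (x + E x) - (x + E x)"
  define l where "l = E x - x + (E x - x)"
  have vS: "v \<in> S" and zS: "z \<in> S" and wS: "w \<in> S" and lS: "l \<in> S"
    by (auto simp: v z_def w_def l_def intro!: mem)
  have zw: "z = w + w" by (simp add: z_def w_def v E_add algebra_simps)
  have zl: "z = E l + l" by (simp add: z_def l_def v E_add E_diff algebra_simps)
  define b where "b n = P (nmul n z)" for n
  have "b (Suc (Suc n)) - 2 * b (Suc n) + b n = P (z + z) - 2 * P z" for n
  proof -
    have "third_diff P (nmul n w + nmul n w) (E l + l) (E v - v) = 0"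
      using E_add S eq vS lS nmul_S[OF wS] by (rule third_diff_eq_0)
    then have "third_diff P (nmul n z) z z = 0"
      by (simp add: nmul_distrib flip: zl z_def) (simp add: zw nmul_distrib)
    then show ?thesis by (simp add: third_diff_def b_def zero algebra_simps)
  qed
  moreover have "\<bar>b n\<bar> \<le> \<bar>M\<bar>" for n
    using nonpos(1)[OF nmul_S[OF zS], of n] bdd[OF nmul_S[OF zS], of n] by (simp add: b_def)
  ultimately have "b 1 = b 0" by (rule bounded_second_difference_const[rotated])
  then have "P z = 0" by (simp add: b_def zero)
  then have "P (E v + v) + Q (E v + E v) = 0"
    using eq[of "E v" v] vS S by (simp add: z_def zero)
  then show ?thesis
    using nonpos(1)[of "E v + v"] nonpos(2)[of "E v + E v"] vS S plus by (smt (verit))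
qed

section \<open>Characteristic functions\<close>

lemma space_Xsp [simp]: "space Xsp = UNIV"
  by (simp add: Xsp_def space_pair_measure)

lemma measurable_fst_Xsp [measurable]: "fst \<in> borel_measurable Xsp"
  and measurable_snd_Xsp [measurable]: "snd \<in> measurable Xsp (count_space UNIV)"
  by (simp_all add: Xsp_def)

lemma measurable_Xsp_Pair [measurable (raw)]:
  "f \<in> borel_measurable M \<Longrightarrow> g \<in> measurable M (count_space UNIV) \<Longrightarrow> (\<lambda>x. (f x, g x)) \<in> measurable M Xsp"
  by (simp add: Xsp_def)

lemma measurable_iexp_char [measurable]: "(\<lambda>x. iexp (s * fst x) * chi (snd x)) \<in> borel_measurable Xsp"
proof -
  have [measurable]: "chi \<in> borel_measurable (count_space UNIV)" by simp
  show ?thesis by measurable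
qed

lemma measurable_xadd [measurable (raw)]:
  fixes f g :: "'a \<Rightarrow> real \<times> 'g::{ab_group_add, finite}"
  assumes [measurable]: "f \<in> measurable M Xsp" "g \<in> measurable M Xsp"
  shows "(\<lambda>w. xadd (f w) (g w)) \<in> measurable M Xsp"
  unfolding xadd_def by measurable

lemma measurable_xneg [measurable (raw)]:
  fixes f :: "'a \<Rightarrow> real \<times> 'g::{ab_group_add, finite}"
  assumes [measurable]: "f \<in> measurable M Xsp"
  shows "(\<lambda>w. xneg (f w)) \<in> measurable M Xsp"
  unfolding xneg_def by measurable

lemma charfunX_distr:
  assumes [measurable]: "X \<in> measurable M Xsp"
  shows "charfunX (distr M Xsp X) s chi = (CLINT w|M. iexp (s * fst (X w)) * chi (snd (X w)))"
  unfolding charfunX_def by (rule integral_distr) measurable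

lemma distrX_integrable:
  assumes "distrX \<mu>" "is_character chi"
  shows "complex_integrable \<mu> (\<lambda>x. iexp (s * fst x) * chi (snd x))"
proof -
  interpret prob_space \<mu> using assms by (simp add: distrX_def)
  have [measurable_cong]: "sets \<mu> = sets Xsp" using assms by (simp add: distrX_def)
  show ?thesis
  proof (rule integrable_const_bound[of _ 1])
    show "(\<lambda>x. iexp (s * fst x) * chi (snd x)) \<in> borel_measurable \<mu>" by measurable
  qed (simp add: norm_mult is_character_norm[OF assms(2)])
qed

text \<open>Fourier inversion on the finite factor only.\<close>
lemma charfunX_restrict:
  fixes \<mu> :: "(real \<times> 'g::{ab_group_add, finite}) measure"
  assumes "distrX \<mu>"
  shows "of_nat (card {chi :: 'g \<Rightarrow> complex. is_character chi})
      * (CLINT x|\<mu>. (if snd x = g then iexp (s * fst x) else 0))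
    = (\<Sum>chi | is_character chi. cnj (chi g) * charfunX \<mu> s chi)"
proof -
  have "(\<Sum>chi | is_character chi. cnj (chi g) * charfunX \<mu> s chi)
      = (CLINT x|\<mu>. (\<Sum>chi | is_character chi. cnj (chi g) * (iexp (s * fst x) * chi (snd x))))"
    unfolding charfunX_def
    by (subst Bochner_Integration.integral_sum)
       (simp_all only: integral_mult_right_zero mem_Collect_eq integrable_mult_right distrX_integrable[OF assms])
  also have "\<dots> = (CLINT x|\<mu>. iexp (s * fst x) * (\<Sum>chi | is_character chi. chi (snd x - g)))"
    by (intro Bochner_Integration.integral_cong refl)
       (auto simp: sum_distrib_left is_character_diff mult_ac intro!: sum.cong)
  also have "\<dots> = (CLINT x|\<mu>. of_nat (card {chi :: 'g \<Rightarrow> complex. is_character chi})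
      * (if snd x = g then iexp (s * fst x) else 0))"
    unfolding sum_characters
    by (intro Bochner_Integration.integral_cong refl) (auto simp: mult.commute)
  finally show ?thesis by simp
qed

text \<open>Inversion on the finite factor recovers the Fourier integral over each slice with fixed
  group component. Levy uniqueness on the line then identifies the slices, and every measurable set
  is a finite disjoint union of slices.\<close>

lemma charfunX_unique:
  fixes \<mu> \<nu> :: "(real \<times> 'g::{ab_group_add, finite}) measure"
  assumes \<mu>: "distrX \<mu>" and \<nu>: "distrX \<nu>"
    and eq: "\<And>s chi. is_character chi \<Longrightarrow> charfunX \<mu> s chi = charfunX \<nu> s chi"
  shows "\<mu> = \<nu>"
proof -
  interpret \<mu>: prob_space \<mu> using \<mu> by (simp add: distrX_def)
  interpret \<nu>: prob_space \<nu> using \<nu> by (simp add: distrX_def)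
  have sets_\<mu> [measurable_cong]: "sets \<mu> = sets Xsp" using \<mu> by (simp add: distrX_def)
  have sets_\<nu> [measurable_cong]: "sets \<nu> = sets Xsp" using \<nu> by (simp add: distrX_def)
  have space: "space \<mu> = UNIV" "space \<nu> = UNIV"
    using sets_eq_imp_space_eq[OF sets_\<mu>] sets_eq_imp_space_eq[OF sets_\<nu>] by simp_all
  have nz: "of_nat (card {chi :: 'g \<Rightarrow> complex. is_character chi}) \<noteq> (0 :: complex)"
    using finite_characters is_character_trivial by (auto simp: card_eq_0_iff)
  have sum_eq: "(\<Sum>chi | is_character chi. cnj (chi g) * charfunX \<mu> s chi)
      = (\<Sum>chi | is_character chi. cnj (chi g) * charfunX \<nu> s chi)" for g s
    by (intro sum.cong) (simp_all add: eq)
  have slice: "(CLINT x|\<mu>. (if snd x = g then iexp (s * fst x) else 0))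
      = (CLINT x|\<nu>. (if snd x = g then iexp (s * fst x) else 0))" for s g
    by (rule mult_left_cancel[OF nz, THEN iffD1])
       (simp only: charfunX_restrict[OF \<mu>] charfunX_restrict[OF \<nu>] sum_eq)
  define \<pi> where "\<pi> g x = (if snd x = g then fst x else 0)" for g and x :: "real \<times> 'g"
  have \<pi>_meas [measurable]: "\<pi> g \<in> borel_measurable Xsp" for g
    unfolding \<pi>_def by measurable
  have slice_meas [measurable]: "{x. snd x = g} \<in> sets Xsp" for g :: 'g
    using measurable_sets[OF measurable_snd_Xsp, of "{g}"] by (simp add: vimage_def)
  \<comment> \<open>The slice integral at frequency 0 is the mass of the slice.\<close>
  have mass: "\<mu>.prob {x. snd x = g} = \<nu>.prob {x. snd x = g}" for g
  proof -
    have "(CLINT x|M. (if snd x = g then iexp (0 * fst x) else 0)) = of_real (measure M {x. snd x = g})"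
      if "sets M = sets Xsp" "prob_space M" for M
    proof -
      interpret prob_space M by fact
      have "{x. snd x = g} \<in> sets M" using that by simp
      moreover have "(\<lambda>x. (if snd x = g then iexp (0 * fst x) else 0) :: complex) = (\<lambda>x. of_real (indicator {x. snd x = g} x))"
        by (auto simp: indicator_def)
      ultimately show ?thesis by simp
    qed
    from this[OF sets_\<mu> \<mu>.prob_space_axioms] this[OF sets_\<nu> \<nu>.prob_space_axioms] show ?thesis
      using slice[of g 0] by simp
  qed
  \<comment> \<open>\<open>\<pi> g\<close> sends everything off the slice \<open>snd x = g\<close> to \<open>0\<close>, so Levy uniqueness applies to a
    probability measure and no normalisation of slices is needed.\<close>
  have char_\<pi>: "char (distr M borel (\<pi> g)) s
      = (CLINT x|M. (if snd x = g then iexp (s * fst x) else 0)) + (1 - of_real (measure M {x. snd x = g}))"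
    if sets [measurable_cong]: "sets M = sets Xsp" and "prob_space M" for M g s
  proof -
    interpret prob_space M by fact
    have [simp]: "space M = UNIV" using sets_eq_imp_space_eq[OF sets] by simp
    have int: "complex_integrable M (\<lambda>x. if snd x = g then iexp (s * fst x) else 0)"
      by (rule integrable_const_bound[of _ 1]) auto
    have "char (distr M borel (\<pi> g)) s = (CLINT x|M. iexp (s * \<pi> g x))"
      unfolding char_def by (rule integral_distr) measurable
    also have "\<dots> = (CLINT x|M. (if snd x = g then iexp (s * fst x) else 0)
        + (1 - of_real (indicator {x. snd x = g} x)))"
      by (intro Bochner_Integration.integral_cong) (auto simp: \<pi>_def)
    also have "\<dots> = (CLINT x|M. (if snd x = g then iexp (s * fst x) else 0))
        + (CLINT x|M. (1 - of_real (indicator {x. snd x = g} x)))"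
      using int by (intro Bochner_Integration.integral_add) (auto simp: emeasure_eq_measure)
    also have "(CLINT x|M. (1 - of_real (indicator {x. snd x = g} x)))
        = (1 - of_real (measure M {x. snd x = g}) :: complex)"
      by (subst Bochner_Integration.integral_diff) (auto simp: emeasure_eq_measure prob_space[simplified])
    finally show ?thesis .
  qed
  have distr_eq: "distr \<mu> borel (\<pi> g) = distr \<nu> borel (\<pi> g)" for g
  proof (rule Levy_uniqueness)
    show "char (distr \<mu> borel (\<pi> g)) = char (distr \<nu> borel (\<pi> g))"
      using char_\<pi>[OF sets_\<mu> \<mu>.prob_space_axioms] char_\<pi>[OF sets_\<nu> \<nu>.prob_space_axioms] slice mass
      by (auto simp: fun_eq_iff)
  qed (auto intro!: \<mu>.real_distribution_distr \<nu>.real_distribution_distr)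
  have rect: "\<mu>.prob {x. snd x = g \<and> fst x \<in> B} = \<nu>.prob {x. snd x = g \<and> fst x \<in> B}"
    if B [measurable]: "B \<in> sets borel" for g B
  proof -
    \<comment> \<open>The complement of the slice is sent to 0, so it contributes its whole mass
      exactly when \<open>0 \<in> B\<close>; the correction is the same for both measures by
      \<open>mass\<close>.\<close>
    have "measure (distr M borel (\<pi> g)) B
        = measure M {x. snd x = g \<and> fst x \<in> B} + (if 0 \<in> B then 1 - measure M {x. snd x = g} else 0)"
      if sets [measurable_cong]: "sets M = sets Xsp" and "prob_space M" for M
    proof -
      interpret prob_space M by fact
      have sp [simp]: "space M = UNIV" using sets_eq_imp_space_eq[OF sets] by simp
      have rect_meas: "{x. snd x = g \<and> fst x \<in> B} \<in> sets M"
      proof -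
        have "{x \<in> space M. snd x = g \<and> fst x \<in> B} \<in> sets M" by measurable
        then show ?thesis by simp
      qed
      have sl: "{x. snd x = g} \<in> sets M" using sets by simp
      have "measure (distr M borel (\<pi> g)) B = prob {x. \<pi> g x \<in> B}"
        by (subst measure_distr) (auto simp: vimage_def)
      also have "{x. \<pi> g x \<in> B} = {x. snd x = g \<and> fst x \<in> B} \<union> (if 0 \<in> B then space M - {x. snd x = g} else {})"
        by (auto simp: \<pi>_def)
      also have "prob \<dots> = prob {x. snd x = g \<and> fst x \<in> B} + prob (if 0 \<in> B then space M - {x. snd x = g} else {})"
        using rect_meas sets.compl_sets[OF sl] by (intro finite_measure_Union) (auto split: if_splits)
      also have "prob (if 0 \<in> B then space M - {x. snd x = g} else {}) = (if 0 \<in> B then 1 - prob {x. snd x = g} else 0)"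
        using prob_compl[OF sl] by simp
      finally show ?thesis .
    qed
    from this[OF sets_\<mu> \<mu>.prob_space_axioms] this[OF sets_\<nu> \<nu>.prob_space_axioms]
    show ?thesis unfolding distr_eq[of g] mass[of g] by linarith
  qed
  show ?thesis
  proof (rule measure_eqI)
    show "sets \<mu> = sets \<nu>" by (simp add: sets_\<mu> sets_\<nu>)
    fix A assume A: "A \<in> sets \<mu>"
    define B where "B g = {t. (t, g) \<in> A}" for g
    have B [measurable]: "B g \<in> sets borel" for g
    proof -
      have "(\<lambda>t. (t, g)) \<in> measurable borel Xsp" by measurable
      from measurable_sets[OF this, of A] A show ?thesis by (simp add: B_def vimage_def sets_\<mu>)
    qed
    have split: "measure M A = (\<Sum>g\<in>UNIV. measure M {x. snd x = g \<and> fst x \<in> B g})"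
      if sets [measurable_cong]: "sets M = sets Xsp" and "prob_space M" for M
    proof -
      interpret prob_space M by fact
      have [simp]: "space M = UNIV" using sets_eq_imp_space_eq[OF sets] by simp
      have "{x \<in> space M. snd x = g \<and> fst x \<in> B g} \<in> sets M" for g by measurable
      then have "prob (\<Union>g\<in>UNIV. {x. snd x = g \<and> fst x \<in> B g}) = (\<Sum>g\<in>UNIV. prob {x. snd x = g \<and> fst x \<in> B g})"
        by (intro finite_measure_finite_Union) (auto simp: disjoint_family_on_def)
      moreover have "(\<Union>g\<in>UNIV. {x. snd x = g \<and> fst x \<in> B g}) = A" by (auto simp: B_def)
      ultimately show ?thesis by simp
    qed
    show "emeasure \<mu> A = emeasure \<nu> A"
      using split[OF sets_\<mu> \<mu>.prob_space_axioms] split[OF sets_\<nu> \<nu>.prob_space_axioms] rect[OF B]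
      by (simp add: \<mu>.emeasure_eq_measure \<nu>.emeasure_eq_measure)
  qed
qed

section \<open>Convolutions, point masses and embedded Gaussians\<close>

lemma distrX_distr: "prob_space M \<Longrightarrow> X \<in> measurable M Xsp \<Longrightarrow> distrX (distr M Xsp X)"
  by (simp add: distrX_def prob_space.prob_space_distr)

lemma convX_measurable:
  fixes \<mu> \<nu> :: "(real \<times> 'g::{ab_group_add, finite}) measure"
  assumes "sets \<mu> = sets Xsp" "sets \<nu> = sets Xsp"
  shows "(\<lambda>(x, y). xadd x y) \<in> measurable (\<mu> \<Otimes>\<^sub>M \<nu>) Xsp"
proof -
  note [measurable_cong] = assms
  show ?thesis unfolding case_prod_beta by measurable
qed

lemma distrX_convX:
  fixes \<mu> \<nu> :: "(real \<times> 'g::{ab_group_add, finite}) measure"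
  assumes "distrX \<mu>" "distrX \<nu>"
  shows "distrX (convX \<mu> \<nu>)"
proof -
  interpret pair_prob_space \<mu> \<nu>
    using assms by (simp add: distrX_def pair_prob_space_def pair_sigma_finite_def prob_space_imp_sigma_finite)
  show ?thesis unfolding convX_def
    by (rule distrX_distr[OF prob_space_axioms convX_measurable]) (use assms in \<open>auto simp: distrX_def\<close>)
qed

lemma charfunX_convX:
  fixes \<mu> \<nu> :: "(real \<times> 'g::{ab_group_add, finite}) measure"
  assumes \<mu>: "distrX \<mu>" and \<nu>: "distrX \<nu>" and chi: "is_character chi"
  shows "charfunX (convX \<mu> \<nu>) s chi = charfunX \<mu> s chi * charfunX \<nu> s chi"
proof -
  interpret pair_prob_space \<mu> \<nu>
    using assms by (simp add: distrX_def pair_prob_space_def pair_sigma_finite_def prob_space_imp_sigma_finite)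
  have sets: "sets \<mu> = sets Xsp" "sets \<nu> = sets Xsp" using assms by (auto simp: distrX_def)
  note [measurable_cong] = sets
  define e where "e x = iexp (s * fst x) * chi (snd x)" for x
  have [measurable]: "e \<in> borel_measurable Xsp" unfolding e_def by measurable
  have e_norm: "norm (e x) = 1" for x by (simp add: e_def norm_mult is_character_norm[OF chi])
  have e_add: "e (xadd x y) = e x * e y" for x y
    by (simp add: e_def xadd_def is_character_add[OF chi] distrib_left exp_add)
  have int: "integrable (\<mu> \<Otimes>\<^sub>M \<nu>) (\<lambda>p. e (fst p) * e (snd p))"
    by (rule integrable_const_bound[of _ 1]) (auto simp: norm_mult e_norm)
  have "charfunX (convX \<mu> \<nu>) s chi = (CLINT p|\<mu> \<Otimes>\<^sub>M \<nu>. e (xadd (fst p) (snd p)))"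
    unfolding charfunX_def convX_def e_def case_prod_beta
    by (rule integral_distr) measurable
  also have "\<dots> = (CLINT x|\<mu>. CLINT y|\<nu>. e x * e y)"
    unfolding e_add using integral_fst'[OF int] by simp
  also have "\<dots> = (CLINT x|\<mu>. e x) * (CLINT y|\<nu>. e y)" by simp
  finally show ?thesis by (simp add: charfunX_def e_def)
qed

lemma distrX_degX: "distrX (degX x)"
  by (simp add: distrX_def degX_def prob_space_return)

lemma charfunX_degX: "charfunX (degX x) s chi = iexp (s * fst x) * chi (snd x)"
  unfolding charfunX_def degX_def by (rule integral_return) (simp, measurable)

lemma distrX_embR: "gaussian_R \<gamma> \<Longrightarrow> distrX (embR \<gamma>)"
  unfolding embR_def by (rule distrX_distr) (auto simp: gaussian_R_def cong: measurable_cong_sets)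

lemma charfunX_embR:
  fixes chi :: "'g::{ab_group_add, finite} \<Rightarrow> complex"
  assumes "sets \<gamma> = sets borel" "is_character chi"
  shows "charfunX (embR \<gamma>) s chi = char \<gamma> s"
proof -
  note [measurable_cong] = assms(1)
  show ?thesis unfolding embR_def
    by (subst charfunX_distr) (auto simp: char_def is_character_0[OF assms(2)])
qed

section \<open>Characteristic functions of random variables\<close>

context prob_space begin

text \<open>With \<open>c\<close> the mean, \<open>|Z - c|^2 = 2 - 2 * Re (cnj c * Z)\<close> is
  nonnegative and has expectation \<open>2 - 2 * |c|^2 = 0\<close>.\<close>

lemma AE_eq_expectation_if_unimodular:
  fixes Z :: "'a \<Rightarrow> complex"
  assumes [measurable]: "Z \<in> borel_measurable M" and norm: "\<And>w. norm (Z w) = 1"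
    and E: "norm (expectation Z) = 1"
  shows "AE w in M. Z w = expectation Z"
proof -
  define c where "c = expectation Z"
  have int: "integrable M Z" by (rule integrable_const_bound[of _ 1]) (auto simp: norm)
  have sq: "(norm (Z w - c))\<^sup>2 = 2 - 2 * Re (cnj c * Z w)" for w
  proof -
    have "(Re (Z w))\<^sup>2 + (Im (Z w))\<^sup>2 = 1" "(Re c)\<^sup>2 + (Im c)\<^sup>2 = 1"
      using norm[of w] E cmod_power2[of "Z w"] cmod_power2[of c] by (simp_all add: c_def)
    moreover have "(norm (Z w - c))\<^sup>2 = (Re (Z w) - Re c)\<^sup>2 + (Im (Z w) - Im c)\<^sup>2"
      by (simp add: cmod_power2)
    ultimately show ?thesis by (simp add: power2_eq_square algebra_simps)
  qed
  have "expectation (\<lambda>w. (norm (Z w - c))\<^sup>2) = 2 - 2 * Re (cnj c * c)"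
    unfolding sq using int by (simp add: prob_space c_def)
  also have "cnj c * c = 1"
    using E complex_norm_square[of c] by (simp add: c_def mult.commute)
  finally have "expectation (\<lambda>w. (norm (Z w - c))\<^sup>2) = 0" by simp
  moreover have "integrable M (\<lambda>w. (norm (Z w - c))\<^sup>2)"
    unfolding sq using int by simp
  ultimately have "AE w in M. (norm (Z w - c))\<^sup>2 = 0"
    by (subst integral_nonneg_eq_0_iff_AE[symmetric]) auto
  then show ?thesis by (simp add: c_def)
qed

definition cf :: "('a \<Rightarrow> real \<times> 'g) \<Rightarrow> real \<Rightarrow> ('g \<Rightarrow> complex) \<Rightarrow> complex" where
  "cf X s chi = charfunX (distr M Xsp X) s chi"

lemma cf_eq:
  "X \<in> measurable M Xsp \<Longrightarrow> cf X s chi = expectation (\<lambda>w. iexp (s * fst (X w)) * chi (snd (X w)))"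
  unfolding cf_def by (rule charfunX_distr)

lemma measurable_iexp_char_compose:
  "X \<in> measurable M Xsp \<Longrightarrow> (\<lambda>w. iexp (s * fst (X w)) * chi (snd (X w))) \<in> borel_measurable M"
  by (rule measurable_compose[OF _ measurable_iexp_char])

lemma cf_integrable:
  assumes "X \<in> measurable M Xsp" "is_character chi"
  shows "integrable M (\<lambda>w. iexp (s * fst (X w)) * chi (snd (X w)))"
  by (rule integrable_const_bound[of _ 1])
     (simp add: norm_mult is_character_norm[OF assms(2)], rule measurable_iexp_char_compose[OF assms(1)])

lemma cf_norm_le:
  assumes "X \<in> measurable M Xsp" "is_character chi"
  shows "norm (cf X s chi) \<le> 1"
proof -
  have "norm (cf X s chi) \<le> expectation (\<lambda>w. norm (iexp (s * fst (X w)) * chi (snd (X w))))"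
    unfolding cf_eq[OF assms(1)] by (rule integral_norm_bound)
  then show ?thesis by (simp add: norm_mult is_character_norm[OF assms(2)] prob_space)
qed

lemma cf_0: "X \<in> measurable M Xsp \<Longrightarrow> cf X 0 (\<lambda>_. 1) = 1"
  by (simp add: cf_eq prob_space)

lemma cf_cnj:
  assumes "X \<in> measurable M Xsp"
  shows "cf X (- s) (\<lambda>g. cnj (chi g)) = cnj (cf X s chi)"
proof -
  have "cf X (- s) (\<lambda>g. cnj (chi g)) = expectation (\<lambda>w. cnj (iexp (s * fst (X w)) * chi (snd (X w))))"
    unfolding cf_eq[OF assms] by (simp add: exp_cnj)
  also have "\<dots> = cnj (cf X s chi)"
    unfolding cf_eq[OF assms] by (rule Bochner_Integration.integral_cnj)
  finally show ?thesis .
qed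

lemma cf_shift:
  fixes X :: "'a \<Rightarrow> real \<times> 'g::{ab_group_add, finite}"
  assumes [measurable]: "X \<in> measurable M Xsp" and chi: "is_character chi"
  shows "cf (\<lambda>w. xadd (X w) c) s chi = cf X s chi * (iexp (s * fst c) * chi (snd c))"
proof -
  have "cf (\<lambda>w. xadd (X w) c) s chi
      = expectation (\<lambda>w. (iexp (s * fst (X w)) * chi (snd (X w))) * (iexp (s * fst c) * chi (snd c)))"
    by (subst cf_eq) (auto simp: xadd_def is_character_add[OF chi] distrib_left exp_add mult_ac)
  then show ?thesis by (simp add: cf_eq)
qed

lemma cf_real_part:
  assumes [measurable]: "X \<in> measurable M Xsp"
  shows "cf X s (\<lambda>_. 1) = char (distr M borel (\<lambda>w. fst (X w))) s"
  unfolding cf_eq[OF assms] char_def by (subst integral_distr) auto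

lemma cf_unimodular_AE:
  assumes [measurable]: "X \<in> measurable M Xsp" and chi: "is_character chi" and "norm (cf X s chi) = 1"
  shows "AE w in M. iexp (s * fst (X w)) * chi (snd (X w)) = cf X s chi"
  unfolding cf_eq[OF assms(1)] using assms
  by (intro AE_eq_expectation_if_unimodular)
     (auto simp: norm_mult is_character_norm cf_eq simp del: of_real_mult intro!: measurable_iexp_char_compose)

lemma AE_ex: "AE w in M. P w \<Longrightarrow> \<exists>w. P w"
  by (metis (mono_tags, lifting) AE_False AE_mp AE_I2 eventually_mono)

text \<open>Every character of \<open>D (snd X)\<close> is almost surely constant. There are
  finitely many characters, so one null set serves for all of them, and characters separate points;
  any good sample point supplies \<open>g0\<close>.\<close>

lemma AE_const_of_unimodular_cf:
  fixes X :: "'a \<Rightarrow> real \<times> 'g::{ab_group_add, finite}" and D :: "'g \<Rightarrow> 'g"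
  assumes X: "X \<in> measurable M Xsp" and D: "\<And>x y. D (x + y) = D x + D y"
    and uni: "\<And>chi. is_character chi \<Longrightarrow> norm (cf X 0 (\<lambda>g. chi (D g))) = 1"
  shows "\<exists>g0. AE w in M. D (snd (X w)) = D g0"
proof -
  have "AE w in M. chi (D (snd (X w))) = cf X 0 (\<lambda>g. chi (D g))" if "is_character chi" for chi
    using cf_unimodular_AE[OF X is_character_compose[OF that D] uni[OF that]] by simp
  then have all: "AE w in M. \<forall>chi\<in>{chi. is_character chi}. chi (D (snd (X w))) = cf X 0 (\<lambda>g. chi (D g))"
    by (intro AE_finite_allI finite_characters) auto
  then obtain w0 where w0: "\<forall>chi\<in>{chi. is_character chi}. chi (D (snd (X w0))) = cf X 0 (\<lambda>g. chi (D g))"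
    using AE_ex by blast
  have "D (snd (X w)) = D (snd (X w0))"
    if w: "\<forall>chi\<in>{chi. is_character chi}. chi (D (snd (X w))) = cf X 0 (\<lambda>g. chi (D g))" for w
  proof (rule ccontr)
    assume "D (snd (X w)) \<noteq> D (snd (X w0))"
    then obtain chi where chi: "is_character chi" "chi (D (snd (X w)) - D (snd (X w0))) \<noteq> 1"
      using characters_separate[of "D (snd (X w)) - D (snd (X w0))"] by auto
    have "chi (D (snd (X w))) = chi (D (snd (X w0)))" using w w0 chi(1) by (metis mem_Collect_eq)
    then show False using chi by (simp add: is_character_diff is_character_cnj_mult)
  qed
  with all show ?thesis by (intro exI[of _ "snd (X w0)"]) (auto elim: AE_mp)
qed

text \<open>Both joint laws are integrated against the character \<open>(s, chi)\<close> of the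
  first form times \<open>(t, psi)\<close> of the second. The integrand factors into a function of
  \<open>X\<close> and a function of \<open>Y\<close>, which independence separates; negating the
  second form replaces \<open>t\<close> by \<open>- t\<close> and \<open>psi\<close> by its
  conjugate.\<close>

lemma cf_symmetry:
  fixes X Y :: "'a \<Rightarrow> real \<times> 'g::{ab_group_add, finite}"
  assumes [measurable]: "X \<in> measurable M Xsp" "Y \<in> measurable M Xsp"
    and indep: "indep_var Xsp X Xsp Y"
    and \<alpha>: "\<And>g h. \<alpha> (g + h) = \<alpha> g + \<alpha> h"
    and symm: "distr M (Xsp \<Otimes>\<^sub>M Xsp) (\<lambda>w. (xadd (X w) (Y w), xadd (X w) (a * fst (Y w), \<alpha> (snd (Y w)))))
        = distr M (Xsp \<Otimes>\<^sub>M Xsp) (\<lambda>w. (xadd (X w) (Y w), xneg (xadd (X w) (a * fst (Y w), \<alpha> (snd (Y w))))))"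
    and chi: "is_character chi" and psi: "is_character psi"
  shows "cf X (s + t) (\<lambda>g. chi g * psi g) * cf Y (s + a * t) (\<lambda>g. chi g * psi (\<alpha> g))
       = cf X (s - t) (\<lambda>g. chi g * cnj (psi g)) * cf Y (s - a * t) (\<lambda>g. chi g * cnj (psi (\<alpha> g)))"
proof -
  have prod: "cf X u p * cf Y v q
      = expectation (\<lambda>w. (iexp (u * fst (X w)) * p (snd (X w))) * (iexp (v * fst (Y w)) * q (snd (Y w))))"
    if "is_character p" "is_character q" for u v p q
  proof -
    have "indep_var borel ((\<lambda>x. iexp (u * fst x) * p (snd x)) \<circ> X) borel ((\<lambda>x. iexp (v * fst x) * q (snd x)) \<circ> Y)"
      by (rule indep_var_compose[OF indep measurable_iexp_char measurable_iexp_char])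
    then have "indep_var borel (\<lambda>w. iexp (u * fst (X w)) * p (snd (X w))) borel (\<lambda>w. iexp (v * fst (Y w)) * q (snd (Y w)))"
      by (simp add: comp_def)
    from indep_var_lebesgue_integral[OF this cf_integrable[OF assms(1) that(1)] cf_integrable[OF assms(2) that(2)]]
    show ?thesis by (simp only: cf_eq[OF assms(1)] cf_eq[OF assms(2)])
  qed
  define L1 where "L1 w = xadd (X w) (Y w)" for w
  define L2 where "L2 w = xadd (X w) (a * fst (Y w), \<alpha> (snd (Y w)))" for w
  define h where "h p = (iexp (s * fst (fst p)) * chi (snd (fst p))) * (iexp (t * fst (snd p)) * psi (snd (snd p)))" for p
  have [measurable]: "L1 \<in> measurable M Xsp" "L2 \<in> measurable M Xsp"
    unfolding L1_def L2_def by measurable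
  have [measurable]: "h \<in> borel_measurable (Xsp \<Otimes>\<^sub>M Xsp)"
    unfolding h_def
    by (intro borel_measurable_times measurable_compose[OF measurable_fst measurable_iexp_char]
          measurable_compose[OF measurable_snd measurable_iexp_char])
  have "expectation (\<lambda>w. h (L1 w, L2 w)) = expectation (\<lambda>w. h (L1 w, xneg (L2 w)))"
  proof -
    have "expectation (\<lambda>w. h (L1 w, L2 w)) = integral\<^sup>L (distr M (Xsp \<Otimes>\<^sub>M Xsp) (\<lambda>w. (L1 w, L2 w))) h"
      by (subst integral_distr) auto
    also have "\<dots> = integral\<^sup>L (distr M (Xsp \<Otimes>\<^sub>M Xsp) (\<lambda>w. (L1 w, xneg (L2 w)))) h"
      using symm by (simp add: L1_def L2_def)
    also have "\<dots> = expectation (\<lambda>w. h (L1 w, xneg (L2 w)))"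
      by (subst integral_distr) auto
    finally show ?thesis .
  qed
  moreover have "h (L1 w, L2 w) = (iexp ((s + t) * fst (X w)) * (chi (snd (X w)) * psi (snd (X w))))
      * (iexp ((s + a * t) * fst (Y w)) * (chi (snd (Y w)) * psi (\<alpha> (snd (Y w)))))" for w
    by (simp add: h_def L1_def L2_def xadd_def is_character_add[OF chi] is_character_add[OF psi]
        distrib_left distrib_right exp_add mult_ac)
  moreover have "h (L1 w, xneg (L2 w)) = (iexp ((s - t) * fst (X w)) * (chi (snd (X w)) * cnj (psi (snd (X w)))))
      * (iexp ((s - a * t) * fst (Y w)) * (chi (snd (Y w)) * cnj (psi (\<alpha> (snd (Y w))))))" for w
  proof -
    have "psi (- x - y) = cnj (psi x) * cnj (psi y)" for x y
      using is_character_minus[OF psi, of "x + y"] by (simp add: is_character_add[OF psi] algebra_simps)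
    then show ?thesis
      by (simp add: h_def L1_def L2_def xadd_def xneg_def is_character_add[OF chi]
        algebra_simps exp_add exp_diff exp_minus field_simps)
  qed
  moreover have "is_character (\<lambda>g. chi g * psi g)" "is_character (\<lambda>g. chi g * psi (\<alpha> g))"
    "is_character (\<lambda>g. chi g * cnj (psi g))" "is_character (\<lambda>g. chi g * cnj (psi (\<alpha> g)))"
    using chi psi is_character_compose[OF psi \<alpha>] by (simp_all add: is_character_mult is_character_cnj)
  ultimately show ?thesis by (simp only: prod)
qed

end

section \<open>The symmetric conditional distribution\<close>

locale heyde_pair = prob_space M for M :: "'s measure" +
  fixes \<xi>1 \<xi>2 :: "'s \<Rightarrow> real \<times> 'g::{ab_group_add, finite}" and a :: real and \<alpha> :: "'g \<Rightarrow> 'g"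
  assumes no_order2: "\<And>g::'g. g + g = 0 \<Longrightarrow> g = 0"
    and a_nz: "a \<noteq> 0"
    and \<alpha>_add: "\<And>g h. \<alpha> (g + h) = \<alpha> g + \<alpha> h"
    and \<alpha>_inj: "inj \<alpha>"
    and rv1 [measurable]: "\<xi>1 \<in> measurable M Xsp"
    and rv2 [measurable]: "\<xi>2 \<in> measurable M Xsp"
    and indep: "indep_var Xsp \<xi>1 Xsp \<xi>2"
    and nonvan1: "\<And>s chi. is_character chi \<Longrightarrow> cf \<xi>1 s chi \<noteq> 0"
    and nonvan2: "\<And>s chi. is_character chi \<Longrightarrow> cf \<xi>2 s chi \<noteq> 0"
    and symm: "distr M (Xsp \<Otimes>\<^sub>M Xsp) (\<lambda>w. (xadd (\<xi>1 w) (\<xi>2 w), xadd (\<xi>1 w) (a * fst (\<xi>2 w), \<alpha> (snd (\<xi>2 w)))))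
        = distr M (Xsp \<Otimes>\<^sub>M Xsp) (\<lambda>w. (xadd (\<xi>1 w) (\<xi>2 w), xneg (xadd (\<xi>1 w) (a * fst (\<xi>2 w), \<alpha> (snd (\<xi>2 w))))))"
begin

lemma \<alpha>_0: "\<alpha> 0 = 0" using \<alpha>_add[of 0 0] by simp

lemma \<alpha>_minus: "\<alpha> (- x) = - \<alpha> x"
  using \<alpha>_add[of x "- x"] \<alpha>_0 by (simp add: add_eq_0_iff)

lemma \<alpha>_diff: "\<alpha> (x - y) = \<alpha> x - \<alpha> y"
  using \<alpha>_add[of x "- y"] by (simp add: \<alpha>_minus)

definition K :: "'g set" where "K = {g. g + \<alpha> g = 0}"

lemma K_add: "x \<in> K \<Longrightarrow> y \<in> K \<Longrightarrow> x + y \<in> K"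
  and K_minus: "x \<in> K \<Longrightarrow> - x \<in> K"
  and K_\<alpha>: "x \<in> K \<Longrightarrow> \<alpha> x = - x"
  by (simp_all add: K_def \<alpha>_add \<alpha>_minus algebra_simps) (simp_all add: add_eq_0_iff algebra_simps)

lemma K_double: "x + x \<in> K \<Longrightarrow> x \<in> K"
  using no_order2[of "x + \<alpha> x"] by (simp add: K_def \<alpha>_add algebra_simps)

section \<open>Concentration of the group components on cosets of K\<close>

lemmas cf_symmetry' = cf_symmetry[OF rv1 rv2 indep \<alpha>_add symm]

definition v :: "'g \<Rightarrow> 'g" where "v g = g + \<alpha> g + (g + \<alpha> g)"
text \<open>In operator form, \<open>v\<close> is \<open>2 * (I + \<alpha>)\<close> and
  \<open>D\<close> is \<open>4 * (I + \<alpha>) \<alpha>\<close>. These are the elements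
  \<open>v\<close> and \<open>E v + E v\<close> of \<open>heyde_bounded_vanishing\<close> when
  \<open>x\<close> is the identity map and \<open>E\<close> is composition with \<alpha>.\<close>

definition D :: "'g \<Rightarrow> 'g" where "D g = v (\<alpha> g) + v (\<alpha> g)"

lemma D_add: "D (x + y) = D x + D y"
  by (simp add: D_def v_def \<alpha>_add algebra_simps)

text \<open>The factor 4 is removed because there is no 2-torsion, and the outer \<alpha> by
  injectivity.\<close>

lemma D_eq_imp_K:
  assumes "D x = D y" shows "x - y \<in> K"
proof -
  define z where "z = \<alpha> (x - y) + \<alpha> (\<alpha> (x - y))"
  have "D x - D y = (z + z) + (z + z)" by (simp add: D_def v_def z_def \<alpha>_diff algebra_simps)
  then have "(z + z) + (z + z) = 0" using assms by (simp only: diff_self)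
  then have "z = 0" by (rule no_order2[OF no_order2])
  then have "\<alpha> ((x - y) + \<alpha> (x - y)) = \<alpha> 0" by (simp only: z_def \<alpha>_add \<alpha>_0)
  with \<alpha>_inj show ?thesis by (simp add: K_def inj_eq)
qed

lemma cf_D_unimodular:
  assumes chi: "is_character chi"
  shows "norm (cf \<xi>1 0 (\<lambda>g. chi (D g))) = 1" "norm (cf \<xi>2 0 (\<lambda>g. chi (D g))) = 1"
proof -
  \<comment> \<open>Characters are indexed by the additive maps \<phi> via
    \<open>chi (\<phi> g)\<close>. Sums and differences of maps correspond to products and quotients
    of characters, and the adjoint of \<alpha> becomes \<open>E\<close>.\<close>
  define S :: "('g \<Rightarrow> 'g) set" where "S = {\<phi>. \<forall>x y. \<phi> (x + y) = \<phi> x + \<phi> y}"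
  define E :: "('g \<Rightarrow> 'g) \<Rightarrow> 'g \<Rightarrow> 'g" where "E \<phi> g = \<phi> (\<alpha> g)" for \<phi> g
  define P where "P \<phi> = ln (norm (cf \<xi>1 0 (\<lambda>g. chi (\<phi> g))))" for \<phi>
  define Q where "Q \<phi> = ln (norm (cf \<xi>2 0 (\<lambda>g. chi (\<phi> g))))" for \<phi>
  have chiS: "is_character (\<lambda>g. chi (\<phi> g))" if "\<phi> \<in> S" for \<phi>
    using that by (intro is_character_compose[OF chi]) (auto simp: S_def)
  have E_add: "E (x + y) = E x + E y" for x y by (simp add: E_def fun_eq_iff)
  have S: "0 \<in> S" "\<And>x y. x \<in> S \<Longrightarrow> y \<in> S \<Longrightarrow> x - y \<in> S" "\<And>x. x \<in> S \<Longrightarrow> E x \<in> S"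
    by (auto simp: S_def E_def \<alpha>_add algebra_simps)
  have eq: "P (x + y) + Q (x + E y) = P (x - y) + Q (x - E y)" if xy: "x \<in> S" "y \<in> S" for x y
  proof -
    have plus: "x' + y' \<in> S" if "x' \<in> S" "y' \<in> S" for x' y'
      using that by (auto simp: S_def algebra_simps)
    have "cf \<xi>1 0 (\<lambda>g. chi ((x + y) g)) * cf \<xi>2 0 (\<lambda>g. chi ((x + E y) g))
        = cf \<xi>1 0 (\<lambda>g. chi ((x - y) g)) * cf \<xi>2 0 (\<lambda>g. chi ((x - E y) g))"
      using cf_symmetry'[OF chiS[OF xy(1)] chiS[OF xy(2)], of 0 0]
      by (simp add: is_character_add[OF chi] is_character_diff[OF chi] E_def)
    then have "norm (cf \<xi>1 0 (\<lambda>g. chi ((x + y) g))) * norm (cf \<xi>2 0 (\<lambda>g. chi ((x + E y) g)))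
        = norm (cf \<xi>1 0 (\<lambda>g. chi ((x - y) g))) * norm (cf \<xi>2 0 (\<lambda>g. chi ((x - E y) g)))"
      by (simp only: flip: norm_mult)
    from arg_cong[where f = ln, OF this] show ?thesis
      unfolding P_def Q_def
      using nonvan1[OF chiS[OF plus[OF xy]], of 0] nonvan1[OF chiS[OF S(2)[OF xy]], of 0]
        nonvan2[OF chiS[OF plus[OF xy(1) S(3)[OF xy(2)]]], of 0]
        nonvan2[OF chiS[OF S(2)[OF xy(1) S(3)[OF xy(2)]]], of 0]
      by (simp only: ln_mult_pos zero_less_norm_iff not_False_eq_True)
  qed
  have even: "P (- x) = P x" "Q (- x) = Q x" for x
    using cf_cnj[OF rv1, of 0 "\<lambda>g. chi (x g)"] cf_cnj[OF rv2, of 0 "\<lambda>g. chi (x g)"]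
    by (simp_all add: P_def Q_def is_character_minus[OF chi])
  have zero: "P 0 = 0" "Q 0 = 0"
    by (simp_all add: P_def Q_def is_character_0[OF chi] cf_0)
  have nonpos: "P x \<le> 0" "Q x \<le> 0" if "x \<in> S" for x
    using nonvan1[OF chiS[OF that]] nonvan2[OF chiS[OF that]]
      cf_norm_le[OF rv1 chiS[OF that]] cf_norm_le[OF rv2 chiS[OF that]]
    by (simp_all add: P_def Q_def)
  have idS: "(\<lambda>g. g) \<in> S" by (simp add: S_def)
  have vv: "v = (\<lambda>g. g) + E (\<lambda>g. g) + ((\<lambda>g. g) + E (\<lambda>g. g))"
    by (simp add: v_def E_def fun_eq_iff)
  have Dv: "D = E v + E v" by (simp add: D_def E_def fun_eq_iff)
  \<comment> \<open>There are finitely many maps from the group to itself, which supplies the lower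
    bound required for the bounded argument.\<close>
  have Min_range: "Min (range f) \<le> f x" for f :: "('g \<Rightarrow> 'g) \<Rightarrow> real" and x
    by (rule Min_le) auto
  have "Q (E v + E v) = 0"
    by (rule heyde_bounded_vanishing[where E = E and S = S and P = P and Q = Q,
          OF E_add S eq zero nonpos Min_range[of P] idS vv])
  moreover have "P (E v + E v) = 0"
  proof -
    \<comment> \<open>The equation at \<open>(E y, x)\<close>, together with evenness, has the same
      shape with \<open>Q\<close> composed with \<open>E\<close> in the role of \<open>P\<close> and
      \<open>P\<close> in the role of \<open>Q\<close>.\<close>
    have eq': "Q (E (x + y)) + P (x + E y) = Q (E (x - y)) + P (x - E y)" if xy: "x \<in> S" "y \<in> S" for x y
    proof -
      have "P (E y + x) + Q (E y + E x) = P (E y - x) + Q (E y - E x)"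
        using eq[OF S(3)[OF xy(2)] xy(1)] .
      moreover have "E (x + y) = E y + E x" by (simp only: E_add add.commute)
      moreover have "E (x - y) = - (E y - E x)" by (rule ext) (simp add: E_def)
      moreover have "x - E y = - (E y - x)" by (simp only: minus_diff_eq)
      moreover have "x + E y = E y + x" by (rule add.commute)
      ultimately show ?thesis by (simp only: even)
    qed
    have "E 0 = 0" by (rule ext) (simp add: E_def)
    then have E0: "Q (E 0) = 0" using zero by simp
    have E_le: "Q (E x) \<le> 0" if "x \<in> S" for x using nonpos(2)[OF S(3)[OF that]] .
    show ?thesis
      by (rule heyde_bounded_vanishing[where E = E and S = S and P = "\<lambda>x. Q (E x)" and Q = P,
            OF E_add S eq' E0 zero(1) E_le nonpos(1)
              Min_range[of "\<lambda>x. Q (E x)"] idS vv])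
  qed
  ultimately show "norm (cf \<xi>1 0 (\<lambda>g. chi (D g))) = 1" "norm (cf \<xi>2 0 (\<lambda>g. chi (D g))) = 1"
    using nonvan1[OF is_character_compose[OF chi D_add]] nonvan2[OF is_character_compose[OF chi D_add]]
    by (simp_all add: P_def Q_def flip: Dv)
qed

text \<open>Shifting \<xi>1 by \<open>\<alpha> g2\<close> and \<xi>2 by \<open>- g2\<close> leaves
  the group component of the second form unchanged, so the symmetry survives. The coset found for
  \<xi>1 must be compatible with this shift, that is, \<open>c = g1 + \<alpha> g2\<close> must lie
  in \<open>K\<close>; this is derived from the symmetry itself.\<close>

lemma ex_shift:
  "\<exists>g2. (AE w in M. snd (\<xi>1 w) + \<alpha> g2 \<in> K) \<and> (AE w in M. snd (\<xi>2 w) - g2 \<in> K)"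
proof -
  obtain g1 where "AE w in M. D (snd (\<xi>1 w)) = D g1"
    using AE_const_of_unimodular_cf[OF rv1 D_add cf_D_unimodular(1)] by blast
  then have g1: "AE w in M. snd (\<xi>1 w) - g1 \<in> K" by (auto intro: D_eq_imp_K)
  obtain g2 where "AE w in M. D (snd (\<xi>2 w)) = D g2"
    using AE_const_of_unimodular_cf[OF rv2 D_add cf_D_unimodular(2)] by blast
  then have g2: "AE w in M. snd (\<xi>2 w) - g2 \<in> K" by (auto intro: D_eq_imp_K)
  define c where "c = g1 + \<alpha> g2"
  define L2 where "L2 w = xadd (\<xi>1 w) (a * fst (\<xi>2 w), \<alpha> (snd (\<xi>2 w)))" for w
  have [measurable]: "L2 \<in> measurable M Xsp" unfolding L2_def by measurable
  have \<alpha>K: "\<alpha> x \<in> K" if "x \<in> K" for x using K_\<alpha>[OF that] K_minus[OF that] by simp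
  have L2_K: "AE w in M. snd (L2 w) - c \<in> K"
    using g1 g2
  proof eventually_elim
    case (elim w)
    have "snd (L2 w) - c = (snd (\<xi>1 w) - g1) + \<alpha> (snd (\<xi>2 w) - g2)"
      by (simp add: L2_def c_def xadd_def \<alpha>_diff)
    then show ?case using elim by (simp only: K_add \<alpha>K)
  qed
  have pred [measurable]: "Measurable.pred (Xsp \<Otimes>\<^sub>M Xsp) (\<lambda>p. snd (snd p) - c \<in> K)" by measurable
  have "AE p in distr M (Xsp \<Otimes>\<^sub>M Xsp) (\<lambda>w. (xadd (\<xi>1 w) (\<xi>2 w), L2 w)). snd (snd p) - c \<in> K"
    using L2_K by (subst AE_distr_iff) auto
  then have "AE p in distr M (Xsp \<Otimes>\<^sub>M Xsp) (\<lambda>w. (xadd (\<xi>1 w) (\<xi>2 w), xneg (L2 w))). snd (snd p) - c \<in> K"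
    by (simp only: L2_def symm)
  then have "AE w in M. - snd (L2 w) - c \<in> K"
    by (subst (asm) AE_distr_iff) (auto simp: xneg_def)
  \<comment> \<open>Both the group component of \<open>L2\<close> and its negative lie in the coset
    \<open>c + K\<close>; adding the two memberships gives \<open>- (c + c) \<in> K\<close>.\<close>
  with L2_K have "AE w in M. snd (L2 w) - c \<in> K \<and> - snd (L2 w) - c \<in> K" by auto
  then obtain w where "snd (L2 w) - c \<in> K" "- snd (L2 w) - c \<in> K" using AE_ex by blast
  from K_minus[OF K_add[OF this]] have "c + c \<in> K" by simp
  then have c: "c \<in> K" by (rule K_double)
  have "AE w in M. snd (\<xi>1 w) + \<alpha> g2 \<in> K"
    using g1
  proof eventually_elim
    case (elim w)
    have "snd (\<xi>1 w) + \<alpha> g2 = (snd (\<xi>1 w) - g1) + c" by (simp add: c_def)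
    then show ?case using elim c by (simp only: K_add)
  qed
  with g2 show ?thesis by blast
qed

end

text \<open>Doubling is injective, hence bijective on a finite group, and its inverse is additive.
  Composition with it provides square roots of characters.\<close>

lemma ex_additive_half:
  assumes "\<And>g::'g::{ab_group_add, finite}. g + g = 0 \<Longrightarrow> g = 0"
  shows "\<exists>h::'g \<Rightarrow> 'g. (\<forall>g. h g + h g = g) \<and> (\<forall>x y. h (x + y) = h x + h y)"
proof -
  have inj: "inj (\<lambda>g::'g. g + g)"
  proof (rule injI)
    fix x y :: 'g
    assume "x + x = y + y"
    then have "(x - y) + (x - y) = 0" by (simp add: algebra_simps)
    then have "x - y = 0" by (rule assms)
    then show "x = y" by simp
  qed
  then have surj: "surj (\<lambda>g::'g. g + g)" by (simp add: finite_UNIV_inj_surj)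
  define h where "h = inv (\<lambda>g::'g. g + g)"
  have h: "h g + h g = g" for g using surj_f_inv_f[OF surj, of g] by (simp add: h_def)
  have "h (x + y) = h x + h y" for x y
  proof (rule injD[OF inj])
    have "h x + h y + (h x + h y) = (h x + h x) + (h y + h y)" by (simp only: ac_simps)
    then show "h (x + y) + h (x + y) = h x + h y + (h x + h y)" by (simp only: h)
  qed
  with h show ?thesis by blast
qed

context prob_space begin

lemma cf_real_continuous:
  fixes X :: "'a \<Rightarrow> real \<times> 'c::{ab_group_add, finite}"
  assumes [measurable]: "X \<in> measurable M Xsp"
  shows "continuous_on UNIV (\<lambda>s. cf X s (\<lambda>_. 1))"
proof -
  have "real_distribution (distr M borel (\<lambda>w. fst (X w)))" by (rule real_distribution_distr) measurable
  from real_distribution.isCont_char[OF this] show ?thesis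
    by (simp add: cf_real_part continuous_on_eq_continuous_at)
qed

text \<open>Modulus 1 at \<open>s\<close> makes \<open>iexp (s * fst X)\<close> almost surely
  constant, so it can be taken out of the expectation.\<close>

lemma cf_real_multiplicative:
  fixes X :: "'a \<Rightarrow> real \<times> 'c::{ab_group_add, finite}"
  assumes X: "X \<in> measurable M Xsp" and "norm (cf X s (\<lambda>_. 1)) = 1"
  shows "cf X (s + t) (\<lambda>_. 1) = cf X s (\<lambda>_. 1) * cf X t (\<lambda>_. 1)"
proof -
  have "cf X (s + t) (\<lambda>_. 1) = expectation (\<lambda>w. cf X s (\<lambda>_. 1) * (iexp (t * fst (X w)) * 1))"
    unfolding cf_eq[OF X, of "s + t"]
  proof (rule integral_cong_AE)
    show "AE w in M. iexp ((s + t) * fst (X w)) * 1 = cf X s (\<lambda>_. 1) * (iexp (t * fst (X w)) * 1)"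
      using cf_unimodular_AE[OF X is_character_trivial assms(2)]
    proof eventually_elim
      case (elim w)
      have "iexp ((s + t) * fst (X w)) * 1 = (iexp (s * fst (X w)) * 1) * (iexp (t * fst (X w)) * 1)"
        by (simp add: distrib_right distrib_left exp_add)
      then show ?case by (simp only: elim)
    qed
  qed (use X in measurable)
  then show ?thesis by (simp add: cf_eq[OF X, of t])
qed

end

section \<open>The pair shifted into the subgroup R x K\<close>

locale heyde_shifted = heyde_pair +
  fixes g2
  assumes shift1: "AE w in M. snd (\<xi>1 w) + \<alpha> g2 \<in> K"
    and shift2: "AE w in M. snd (\<xi>2 w) - g2 \<in> K"
begin

definition "\<eta>1 w = xadd (\<xi>1 w) (0, \<alpha> g2)"
definition "\<eta>2 w = xadd (\<xi>2 w) (0, - g2)"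

lemma \<eta>_meas [measurable]: "\<eta>1 \<in> measurable M Xsp" "\<eta>2 \<in> measurable M Xsp"
  unfolding \<eta>1_def \<eta>2_def by measurable

lemma \<eta>_K: "AE w in M. snd (\<eta>1 w) \<in> K" "AE w in M. snd (\<eta>2 w) \<in> K"
  using shift1 shift2 by (simp_all add: \<eta>1_def \<eta>2_def xadd_def)

lemma cf_\<eta>1: "is_character chi \<Longrightarrow> cf \<eta>1 s chi = cf \<xi>1 s chi * chi (\<alpha> g2)"
  and cf_\<eta>2: "is_character chi \<Longrightarrow> cf \<eta>2 s chi = cf \<xi>2 s chi * chi (- g2)"
  unfolding \<eta>1_def \<eta>2_def by (simp_all add: cf_shift)

lemma cf_\<eta>_nonzero:
  assumes "is_character chi"
  shows "cf \<eta>1 s chi \<noteq> 0" "cf \<eta>2 s chi \<noteq> 0"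
  using nonvan1[OF assms, of s] nonvan2[OF assms, of s] is_character_norm[OF assms, of "\<alpha> g2"]
    is_character_norm[OF assms, of "- g2"]
  by (auto simp: cf_\<eta>1[OF assms] cf_\<eta>2[OF assms])

text \<open>Almost surely \<eta>2 has its group component in \<open>K\<close>, where \<alpha> is
  negation; so \<open>psi\<close> after \<alpha> is the conjugate of \<open>psi\<close>.\<close>

lemma cf_\<eta>2_\<alpha>:
  assumes "is_character chi" "is_character psi"
  shows "cf \<eta>2 s (\<lambda>g. chi g * psi (\<alpha> g)) = cf \<eta>2 s (\<lambda>g. chi g * cnj (psi g))"
  unfolding cf_eq[OF \<eta>_meas(2)]
proof (rule integral_cong_AE)
  show "AE w in M. iexp (s * fst (\<eta>2 w)) * (chi (snd (\<eta>2 w)) * psi (\<alpha> (snd (\<eta>2 w))))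
      = iexp (s * fst (\<eta>2 w)) * (chi (snd (\<eta>2 w)) * cnj (psi (snd (\<eta>2 w))))"
    using \<eta>_K(2) by eventually_elim (simp add: K_\<alpha> is_character_minus[OF assms(2)])
qed (rule measurable_iexp_char_compose[OF \<eta>_meas(2), where chi = "\<lambda>g. chi g * psi (\<alpha> g)"],
     rule measurable_iexp_char_compose[OF \<eta>_meas(2), where chi = "\<lambda>g. chi g * cnj (psi g)"])

text \<open>The shifts contribute the same constant on both sides: \<alpha> sends
  \<open>- g2\<close> to the negative of the shift of \<xi>1, so \<open>psi (\<alpha> g2)\<close>
  meets its own conjugate each time.\<close>

lemma cf_\<eta>_mult_eq:
  assumes chi: "is_character chi" and psi: "is_character psi"
  shows "cf \<eta>1 (s + t) (\<lambda>g. chi g * psi g) * cf \<eta>2 (s + a * t) (\<lambda>g. chi g * cnj (psi g))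
       = cf \<eta>1 (s - t) (\<lambda>g. chi g * cnj (psi g)) * cf \<eta>2 (s - a * t) (\<lambda>g. chi g * psi g)"
proof -
  note ch = is_character_mult is_character_cnj chi psi is_character_compose[OF psi \<alpha>_add]
  have 1: "cf \<eta>2 u (\<lambda>g. chi g * cnj (psi g)) = cf \<xi>2 u (\<lambda>g. chi g * psi (\<alpha> g)) * (chi (- g2) * psi (\<alpha> (- g2)))" for u
    unfolding cf_\<eta>2_\<alpha>[OF chi psi, symmetric] by (rule cf_\<eta>2) (intro ch)
  have 2: "cf \<eta>2 u (\<lambda>g. chi g * psi g) = cf \<xi>2 u (\<lambda>g. chi g * cnj (psi (\<alpha> g))) * (chi (- g2) * cnj (psi (\<alpha> (- g2))))" for u
  proof -
    have "cf \<eta>2 u (\<lambda>g. chi g * psi g) = cf \<eta>2 u (\<lambda>g. chi g * cnj (psi (\<alpha> g)))"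
      using cf_\<eta>2_\<alpha>[OF chi is_character_cnj[OF psi], of u] by simp
    then show ?thesis by (simp add: cf_\<eta>2 ch)
  qed
  have 3: "cf \<eta>1 u (\<lambda>g. chi g * psi g) = cf \<xi>1 u (\<lambda>g. chi g * psi g) * (chi (\<alpha> g2) * psi (\<alpha> g2))"
      "cf \<eta>1 u (\<lambda>g. chi g * cnj (psi g)) = cf \<xi>1 u (\<lambda>g. chi g * cnj (psi g)) * (chi (\<alpha> g2) * cnj (psi (\<alpha> g2)))" for u
    by (simp_all add: cf_\<eta>1 ch)
  have "cf \<eta>1 (s + t) (\<lambda>g. chi g * psi g) * cf \<eta>2 (s + a * t) (\<lambda>g. chi g * cnj (psi g))
      = (cf \<xi>1 (s + t) (\<lambda>g. chi g * psi g) * cf \<xi>2 (s + a * t) (\<lambda>g. chi g * psi (\<alpha> g)))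
        * (chi (\<alpha> g2) * chi (- g2)) * (psi (\<alpha> g2) * cnj (psi (\<alpha> g2)))"
    by (simp add: 1 3 \<alpha>_minus is_character_minus[OF psi])
  also have "\<dots> = (cf \<xi>1 (s - t) (\<lambda>g. chi g * cnj (psi g)) * cf \<xi>2 (s - a * t) (\<lambda>g. chi g * cnj (psi (\<alpha> g))))
        * (chi (\<alpha> g2) * chi (- g2)) * (psi (\<alpha> g2) * cnj (psi (\<alpha> g2)))"
    by (simp only: cf_symmetry'[OF chi psi])
  also have "\<dots> = cf \<eta>1 (s - t) (\<lambda>g. chi g * cnj (psi g)) * cf \<eta>2 (s - a * t) (\<lambda>g. chi g * psi g)"
    by (simp add: 2 3 \<alpha>_minus is_character_minus[OF psi])
  finally show ?thesis .
qed

text \<open>Every character is a square because doubling is invertible on the group, so the products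
  and quotients of two characters are two arbitrary characters.\<close>
lemma cf_\<eta>_eq:
  assumes x: "is_character x" and y: "is_character y"
  shows "cf \<eta>1 (s + t) x * cf \<eta>2 (s + a * t) y = cf \<eta>1 (s - t) y * cf \<eta>2 (s - a * t) x"
proof -
  obtain h :: "'b \<Rightarrow> 'b" where h: "\<And>g. h g + h g = g" "\<And>x y. h (x + y) = h x + h y"
    using ex_additive_half[OF no_order2] by blast
  have sq: "x (h g) * x (h g) = x g" "y (h g) * y (h g) = y g" for g
    by (simp_all add: h(1) flip: is_character_add[OF x] is_character_add[OF y])
  \<comment> \<open>These are square roots of \<open>x * y\<close> and of
    \<open>x / y\<close>.\<close>
  define chi where "chi g = x (h g) * y (h g)" for g
  define psi where "psi g = x (h g) * cnj (y (h g))" for g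
  note half = is_character_compose[OF x h(2)] is_character_compose[OF y h(2)]
  have "is_character chi" "is_character psi"
    unfolding chi_def psi_def
    by (rule is_character_mult[OF half], rule is_character_mult[OF half(1) is_character_cnj[OF half(2)]])
  moreover have "(\<lambda>g. chi g * psi g) = x"
  proof
    fix g
    have "chi g * psi g = (x (h g) * x (h g)) * (y (h g) * cnj (y (h g)))"
      by (simp only: chi_def psi_def mult_ac)
    then show "chi g * psi g = x g" by (simp only: sq is_character_cnj_mult[OF y] mult_1_right)
  qed
  moreover have "(\<lambda>g. chi g * cnj (psi g)) = y"
  proof
    fix g
    have "chi g * cnj (psi g) = (y (h g) * y (h g)) * (x (h g) * cnj (x (h g)))"
      by (simp only: chi_def psi_def complex_cnj_mult complex_cnj_cnj mult_ac)
    then show "chi g * cnj (psi g) = y g" by (simp only: sq is_character_cnj_mult[OF x] mult_1_right)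
  qed
  ultimately show ?thesis using cf_\<eta>_mult_eq[of chi psi s t] by simp
qed

lemma cf_\<eta>_0: "cf \<eta>1 0 (\<lambda>_. 1) = 1" "cf \<eta>2 0 (\<lambda>_. 1) = 1"
  by (simp_all add: cf_0)

lemma cf_\<eta>_finite_part: "is_character y \<Longrightarrow> cf \<eta>2 0 y = cf \<eta>1 0 y"
  using cf_\<eta>_eq[OF is_character_trivial, of y 0 0] by (simp add: cf_\<eta>_0)

text \<open>The equation at \<open>(t, t)\<close> with \<open>t = s / (1 + a)\<close> places \<eta>2
  at \<open>s\<close> and \<eta>1 at 0. Comparison with the instance for trivial \<open>y\<close>
  eliminates the remaining terms, by nonvanishing.\<close>

lemma cf_\<eta>_factor2:
  assumes "a \<noteq> -1" "is_character y"
  shows "cf \<eta>2 s y = cf \<eta>2 s (\<lambda>_. 1) * cf \<eta>1 0 y"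
proof -
  define t where "t = s / (1 + a)"
  have t: "t + a * t = s"
  proof -
    have "1 + a \<noteq> 0" using assms(1) by linarith
    moreover have "t + a * t = (1 + a) * t" by (simp add: distrib_right)
    ultimately show ?thesis by (simp add: t_def)
  qed
  have "cf \<eta>1 (t + t) (\<lambda>_. 1) * cf \<eta>2 s y = cf \<eta>1 0 y * cf \<eta>2 (t - a * t) (\<lambda>_. 1)"
    using cf_\<eta>_eq[OF is_character_trivial assms(2), of t t] by (simp add: t)
  also have "cf \<eta>2 (t - a * t) (\<lambda>_. 1) = cf \<eta>1 (t + t) (\<lambda>_. 1) * cf \<eta>2 s (\<lambda>_. 1)"
    using cf_\<eta>_eq[OF is_character_trivial is_character_trivial, of t t] by (simp add: t cf_\<eta>_0)
  finally show ?thesis using cf_\<eta>_nonzero(1)[OF is_character_trivial, of "t + t"] by simp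
qed

text \<open>The same comparison at \<open>(- a * t, t)\<close> with
  \<open>t = - s / (1 + a)\<close>, where \<eta>2 sits at 0 with \<open>y\<close> and \<eta>1 at
  \<open>s\<close>; \<open>cf_\<eta>_finite_part\<close> replaces \<eta>2 by \<eta>1 at 0.\<close>

lemma cf_\<eta>_factor1:
  assumes "a \<noteq> -1" "is_character y"
  shows "cf \<eta>1 s y = cf \<eta>1 s (\<lambda>_. 1) * cf \<eta>1 0 y"
proof -
  define t where "t = - s / (1 + a)"
  have t: "- (a * t) - t = s"
  proof -
    have "1 + a \<noteq> 0" using assms(1) by linarith
    moreover have "- (a * t) - t = - ((1 + a) * t)" by (simp add: distrib_right)
    ultimately show ?thesis by (simp add: t_def)
  qed
  have "cf \<eta>1 s y * cf \<eta>2 (- (a * t) - a * t) (\<lambda>_. 1) = cf \<eta>1 (- (a * t) + t) (\<lambda>_. 1) * cf \<eta>1 0 y"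
    using cf_\<eta>_eq[OF is_character_trivial assms(2), of "- (a * t)" t]
    by (simp add: t cf_\<eta>_finite_part[OF assms(2)])
  also have "cf \<eta>1 (- (a * t) + t) (\<lambda>_. 1) = cf \<eta>1 s (\<lambda>_. 1) * cf \<eta>2 (- (a * t) - a * t) (\<lambda>_. 1)"
    using cf_\<eta>_eq[OF is_character_trivial is_character_trivial, of "- (a * t)" t] by (simp add: t cf_\<eta>_0)
  finally show ?thesis using cf_\<eta>_nonzero(2)[OF is_character_trivial, of "- (a * t) - a * t"] by simp
qed

lemma gauss_cf_\<eta>:
  assumes "a \<noteq> -1"
  shows "gauss_cf (\<lambda>s. cf \<eta>1 s (\<lambda>_. 1)) \<and> gauss_cf (\<lambda>s. cf \<eta>2 s (\<lambda>_. 1))"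
proof -
  note triv = is_character_trivial
  have herm: "cf X (- s) (\<lambda>_. 1) = cnj (cf X s (\<lambda>_. 1))" if "X \<in> measurable M Xsp" for X :: "'a \<Rightarrow> real \<times> 'b" and s
    using cf_cnj[OF that, of s "\<lambda>_. 1"] by simp
  show ?thesis
  proof (cases "a = 1")
    case False
    show ?thesis
      by (rule heyde_real[where a = a])
         (use assms False a_nz in \<open>simp_all add: cf_real_continuous cf_\<eta>_nonzero triv cf_\<eta>_0 herm cf_norm_le cf_\<eta>_eq\<close>)
  next
    case True
    have le: "norm (cf \<eta>1 s (\<lambda>_. 1)) \<le> 1" "norm (cf \<eta>2 s (\<lambda>_. 1)) \<le> 1" for s
      by (simp_all add: cf_norm_le triv)
    \<comment> \<open>\<open>heyde_real\<close> excludes \<open>a = 1\<close>. Here the equation at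
      \<open>(s / 2, s / 2)\<close> has value 1 on the right, so two factors of modulus at most 1
      have product 1.\<close>
    have prod: "cf \<eta>1 s (\<lambda>_. 1) * cf \<eta>2 s (\<lambda>_. 1) = 1" for s
      using cf_\<eta>_eq[OF triv triv, of "s / 2" "s / 2"] by (simp add: True cf_\<eta>_0)
    have "norm (cf \<eta>1 s (\<lambda>_. 1)) * norm (cf \<eta>2 s (\<lambda>_. 1)) = 1" for s
      unfolding norm_mult[symmetric] prod by simp
    then have "norm (cf \<eta>1 s (\<lambda>_. 1)) = 1" "norm (cf \<eta>2 s (\<lambda>_. 1)) = 1" for s
      using le[of s] mult_left_le_one_le[of "norm (cf \<eta>2 s (\<lambda>_. 1))" "norm (cf \<eta>1 s (\<lambda>_. 1))"]
        mult_left_le[of "norm (cf \<eta>2 s (\<lambda>_. 1))" "norm (cf \<eta>1 s (\<lambda>_. 1))"]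
      by (smt (verit) norm_ge_zero)+
    then show ?thesis
      by (intro conjI gauss_cf_multiplicative) (simp_all add: cf_real_continuous cf_real_multiplicative herm)
  qed
qed

section \<open>Recovery of the original distributions\<close>

lemma unshift:
  fixes X :: "'a \<Rightarrow> real \<times> 'b"
  assumes X [measurable]: "X \<in> measurable M Xsp" and \<nu>: "distrX \<nu>"
    and eq: "\<And>s chi. is_character chi \<Longrightarrow> cf (\<lambda>w. xadd (X w) (0, - g)) s chi = charfunX \<nu> s chi"
  shows "distr M Xsp X = convX \<nu> (degX (0, g))"
proof (rule charfunX_unique)
  show "distrX (distr M Xsp X)" by (intro distrX_distr prob_space_axioms X)
  show "distrX (convX \<nu> (degX (0, g)))" by (intro distrX_convX distrX_degX \<nu>)
  fix s :: real and chi :: "'b \<Rightarrow> complex" assume chi: "is_character chi"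
  have "charfunX \<nu> s chi = cf X s chi * cnj (chi g)"
    unfolding eq[OF chi, symmetric] by (simp add: cf_shift[OF X chi] is_character_minus[OF chi])
  then show "charfunX (distr M Xsp X) s chi = charfunX (convX \<nu> (degX (0, g))) s chi"
    by (simp add: charfunX_convX \<nu> distrX_degX chi charfunX_degX cf_def[symmetric] mult.assoc
        mult.commute[of "cnj _"] is_character_cnj_mult)
qed

lemma \<eta>1_unshift: "(\<lambda>w. xadd (\<xi>1 w) (0, - (- \<alpha> g2))) = \<eta>1"
  and \<eta>2_unshift: "(\<lambda>w. xadd (\<xi>2 w) (0, - g2)) = \<eta>2"
  by (simp_all add: \<eta>1_def \<eta>2_def fun_eq_iff)

lemma conclusion_minus_one:
  assumes "a = -1"
  shows "\<exists>\<omega> x1 x2. distrX \<omega> \<and> emeasure \<omega> (space Xsp - UNIV \<times> K) = 0 \<and>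
    distr M Xsp \<xi>1 = convX \<omega> (degX x1) \<and> distr M Xsp \<xi>2 = convX \<omega> (degX x2)"
proof -
  \<comment> \<open>For \<open>a = -1\<close> the equation at \<open>(s / 2, s / 2)\<close> with
    trivial \<open>y\<close> puts the remaining terms at 0, so the law of \<eta>1 serves as the
    common \<omega>.\<close>
  have eq: "cf \<eta>2 s chi = cf \<eta>1 s chi" if "is_character chi" for s chi
    using cf_\<eta>_eq[OF that is_character_trivial, of "s / 2" "s / 2"] by (simp add: assms cf_\<eta>_0)
  define \<omega> where "\<omega> = distr M Xsp \<eta>1"
  have \<omega>: "distrX \<omega>" unfolding \<omega>_def by (intro distrX_distr prob_space_axioms \<eta>_meas)
  have snd_K_sets: "{x. snd x \<in> K} \<in> sets Xsp"
    using measurable_sets[OF measurable_snd_Xsp, of K] by (simp add: vimage_def)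
  have "AE x in \<omega>. snd x \<in> K"
    unfolding \<omega>_def using \<eta>_K(1) snd_K_sets by (subst AE_distr_iff) auto
  then have "AE x in \<omega>. x \<notin> space Xsp - UNIV \<times> K" by eventually_elim (auto simp: mem_Times_iff)
  moreover have "space Xsp - UNIV \<times> K \<in> sets \<omega>"
  proof -
    have "UNIV \<times> K \<in> sets Xsp" unfolding Xsp_def by (intro pair_measureI) auto
    from sets.compl_sets[OF this] show ?thesis by (simp add: \<omega>_def)
  qed
  ultimately have "emeasure \<omega> (space Xsp - UNIV \<times> K) = 0"
    by (intro null_setsD1) (simp only: AE_iff_null_sets)
  moreover have "distr M Xsp \<xi>1 = convX \<omega> (degX (0, - \<alpha> g2))"
    by (rule unshift[OF rv1 \<omega>]) (simp only: \<eta>1_unshift, simp add: \<omega>_def cf_def)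
  moreover have "distr M Xsp \<xi>2 = convX \<omega> (degX (0, g2))"
    by (rule unshift[OF rv2 \<omega>]) (simp only: \<eta>2_unshift eq, simp add: \<omega>_def cf_def)
  ultimately show ?thesis using \<omega> by blast
qed

lemma conclusion_gaussian:
  assumes "a \<noteq> -1"
  shows "\<exists>\<gamma>1 \<gamma>2 \<omega> x1 x2. gaussian_R \<gamma>1 \<and> gaussian_R \<gamma>2 \<and> distrX \<omega> \<and>
    emeasure \<omega> (space Xsp - {0} \<times> K) = 0 \<and>
    distr M Xsp \<xi>1 = convX (convX (embR \<gamma>1) \<omega>) (degX x1) \<and>
    distr M Xsp \<xi>2 = convX (convX (embR \<gamma>2) \<omega>) (degX x2)"
proof -
  define \<gamma> where "\<gamma> X = distr M borel (\<lambda>w. fst (X w))" for X :: "'a \<Rightarrow> real \<times> 'b"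
  have gauss: "gaussian_R (\<gamma> X)" if X [measurable]: "X \<in> measurable M Xsp" and "gauss_cf (\<lambda>s. cf X s (\<lambda>_. 1))" for X
    using that(2) unfolding gaussian_R_def \<gamma>_def gauss_cf_def cf_real_part[OF X]
    by (auto intro!: prob_space_distr)
  have \<gamma>1: "gaussian_R (\<gamma> \<eta>1)" and \<gamma>2: "gaussian_R (\<gamma> \<eta>2)"
    using gauss[OF \<eta>_meas(1)] gauss[OF \<eta>_meas(2)] gauss_cf_\<eta>[OF assms] by blast+
  \<comment> \<open>The law of \<zeta> has characteristic function \<open>cf \<eta>1 0 chi\<close>,
    the factor shared by \<open>cf_\<eta>_factor1\<close> and \<open>cf_\<eta>_factor2\<close>; the
    same \<omega> therefore fits both distributions.\<close>
  define \<zeta> where "\<zeta> w = (0 :: real, snd (\<eta>1 w))" for w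
  have \<zeta> [measurable]: "\<zeta> \<in> measurable M Xsp" unfolding \<zeta>_def by measurable
  define \<omega> where "\<omega> = distr M Xsp \<zeta>"
  have \<omega>: "distrX \<omega>" unfolding \<omega>_def by (intro distrX_distr prob_space_axioms \<zeta>)
  have cf_\<omega>: "charfunX \<omega> s chi = cf \<eta>1 0 chi" for s chi
    by (simp add: \<omega>_def charfunX_distr[OF \<zeta>] cf_eq[OF \<eta>_meas(1)]) (simp add: \<zeta>_def)
  have supp_meas: "{0} \<times> K \<in> sets Xsp" unfolding Xsp_def by (intro pair_measureI) auto
  have "AE x in \<omega>. x \<in> {0} \<times> K"
    unfolding \<omega>_def using \<eta>_K(1) by (subst AE_distr_iff) (auto simp: \<zeta>_def supp_meas)
  then have "AE x in \<omega>. x \<notin> space Xsp - {0} \<times> K" by eventually_elim auto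
  moreover have "space Xsp - {0} \<times> K \<in> sets \<omega>"
    using sets.compl_sets[OF supp_meas] by (simp add: \<omega>_def)
  ultimately have "emeasure \<omega> (space Xsp - {0} \<times> K) = 0"
    by (intro null_setsD1) (simp only: AE_iff_null_sets)
  moreover have cf_conv: "charfunX (convX (embR (\<gamma> X)) \<omega>) s chi = cf X s (\<lambda>_. 1) * cf \<eta>1 0 chi"
    if X: "X \<in> measurable M Xsp" and "gaussian_R (\<gamma> X)" and chi: "is_character chi" for X s chi
    using that by (simp add: charfunX_convX distrX_embR \<omega> cf_\<omega> charfunX_embR[OF _ chi] gaussian_R_def)
      (simp add: \<gamma>_def cf_real_part)
  have "distr M Xsp \<xi>1 = convX (convX (embR (\<gamma> \<eta>1)) \<omega>) (degX (0, - \<alpha> g2))"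
    by (rule unshift[OF rv1 distrX_convX[OF distrX_embR[OF \<gamma>1] \<omega>]])
       (simp only: \<eta>1_unshift cf_conv[OF \<eta>_meas(1) \<gamma>1] cf_\<eta>_factor1[OF assms, symmetric])
  moreover have "distr M Xsp \<xi>2 = convX (convX (embR (\<gamma> \<eta>2)) \<omega>) (degX (0, g2))"
    by (rule unshift[OF rv2 distrX_convX[OF distrX_embR[OF \<gamma>2] \<omega>]])
       (simp only: \<eta>2_unshift cf_conv[OF \<eta>_meas(2) \<gamma>2] cf_\<eta>_factor2[OF assms, symmetric])
  ultimately show ?thesis using \<gamma>1 \<gamma>2 \<omega> by blast
qed

end

theorem theorem3p1:
  fixes M :: "'s measure"
    and \<xi>1 \<xi>2 :: "'s \<Rightarrow> real \<times> 'g::{ab_group_add, finite}"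
    and a :: real
    and \<alpha>G :: "'g \<Rightarrow> 'g"
  assumes no_order2: "\<forall>g::'g. g + g = 0 \<longrightarrow> g = 0"
    and a_nz: "a \<noteq> 0"
    and \<alpha>G_hom: "\<forall>g h. \<alpha>G (g + h) = \<alpha>G g + \<alpha>G h"
    and \<alpha>G_bij: "bij \<alpha>G"
    and M: "prob_space M"
    and rv1: "\<xi>1 \<in> measurable M Xsp"
    and rv2: "\<xi>2 \<in> measurable M Xsp"
    and indep: "prob_space.indep_var M Xsp \<xi>1 Xsp \<xi>2"
    and nonvan1: "\<forall>s chi. is_character chi \<longrightarrow> charfunX (distr M Xsp \<xi>1) s chi \<noteq> 0"
    and nonvan2: "\<forall>s chi. is_character chi \<longrightarrow> charfunX (distr M Xsp \<xi>2) s chi \<noteq> 0"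
    and symm: "distr M (Xsp \<Otimes>\<^sub>M Xsp)
                 (\<lambda>w. (xadd (\<xi>1 w) (\<xi>2 w),
                       xadd (\<xi>1 w) (a * fst (\<xi>2 w), \<alpha>G (snd (\<xi>2 w)))))
             = distr M (Xsp \<Otimes>\<^sub>M Xsp)
                 (\<lambda>w. (xadd (\<xi>1 w) (\<xi>2 w),
                       xneg (xadd (\<xi>1 w) (a * fst (\<xi>2 w), \<alpha>G (snd (\<xi>2 w))))))"
  shows "(a \<noteq> -1 \<longrightarrow>
            (\<exists>\<gamma>1 \<gamma>2 \<omega> x1 x2.
               gaussian_R \<gamma>1 \<and> gaussian_R \<gamma>2 \<and> distrX \<omega> \<and>
               \<omega> (space Xsp - {0} \<times> {g. g + \<alpha>G g = 0}) = 0 \<and>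
               distr M Xsp \<xi>1 = convX (convX (embR \<gamma>1) \<omega>) (degX x1) \<and>
               distr M Xsp \<xi>2 = convX (convX (embR \<gamma>2) \<omega>) (degX x2)))
       \<and> (a = -1 \<longrightarrow>
            (\<exists>\<omega> x1 x2.
               distrX \<omega> \<and>
               \<omega> (space Xsp - UNIV \<times> {g. g + \<alpha>G g = 0}) = 0 \<and>
               distr M Xsp \<xi>1 = convX \<omega> (degX x1) \<and>
               distr M Xsp \<xi>2 = convX \<omega> (degX x2)))"
proof -
  interpret prob_space M by fact
  interpret heyde_pair M \<xi>1 \<xi>2 a \<alpha>G
  proof
    show "inj \<alpha>G" using \<alpha>G_bij by (rule bij_is_inj)
    show "cf \<xi>1 s chi \<noteq> 0" "cf \<xi>2 s chi \<noteq> 0" if "is_character chi" for s chi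
      using nonvan1 nonvan2 that by (simp_all add: cf_def)
  qed (use no_order2 \<alpha>G_hom in blast, (fact a_nz rv1 rv2 indep symm | use \<alpha>G_hom in blast)+)
  obtain g2 where "AE w in M. snd (\<xi>1 w) + \<alpha>G g2 \<in> K" "AE w in M. snd (\<xi>2 w) - g2 \<in> K"
    using ex_shift by blast
  then interpret heyde_shifted M \<xi>1 \<xi>2 a \<alpha>G g2 by unfold_locales
  show ?thesis
    using conclusion_gaussian conclusion_minus_one unfolding K_def by blast
qed

end
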